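(* Let $r\in\mathbb{Q}\setminus\{0,1,-1\}$ and let $S$ be a set of rational primes, not equal to the set of all rational primes, such that $|r|_p=1$ for every rational prime $p\notin S$. If $F_S$ has radius of convergence $1$, then $F_S$ has the unit circle as a natural boundary.
   Context: For a set $S$ of rational primes and $x\in\mathbb{Q}$, $|x|_S=\prod_{p\in S}|x|_p$ with $|\cdot|_p$ the usual $p$-adic absolute value; $|\cdot|$ is the usual real absolute value. Define $f_S(n)=|r^n-1|\cdot|r^n-1|_S$ for $n\geqslant 1$ and $F_S(z)=\sum_{n\geqslant 1}f_S(n)z^n$. The circle of convergence of a power series is a natural boundary if the series has no analytic continuation to any connected open set properly containing its open disc of convergence (equivalently, every point of the circle is a singularity). *)

theory Defs
  imports
    "HOL-Complex_Analysis.Complex_Analysis"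
    "HOL-Computational_Algebra.Primes"
begin

definition padic_abs :: "nat \<Rightarrow> rat \<Rightarrow> real" where
  "padic_abs p x =
     (if x = 0 then 0
      else real p powi (int (multiplicity (int p) (snd (quotient_of x)))
                        - int (multiplicity (int p) (fst (quotient_of x)))))"

text \<open>
  For \<open>x \<noteq> 0\<close> only finitely many primes contribute a factor different from \<open>1\<close> (see
  \<open>finite_padic_abs_neq_1\<close> below), so the product over a possibly infinite \<open>S\<close> is the finite
  product of those factors. The case \<open>x = 0\<close> is separate because \<^term>\<open>prod\<close> over an infinite set
  is \<open>1\<close>.
\<close>

definition S_abs :: "nat set \<Rightarrow> rat \<Rightarrow> real" where
  "S_abs S x =
     (if x = 0 \<and> S \<noteq> {} then 0 else (\<Prod>p \<in> {p \<in> S. padic_abs p x \<noteq> 1}. padic_abs p x))"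

definition f_S :: "rat \<Rightarrow> nat set \<Rightarrow> nat \<Rightarrow> real" where
  "f_S r S n = \<bar>real_of_rat (r ^ n - 1)\<bar> * S_abs S (r ^ n - 1)"

definition F_S :: "rat \<Rightarrow> nat set \<Rightarrow> complex fps" where
  "F_S r S = Abs_fps (\<lambda>n. if n = 0 then 0 else complex_of_real (f_S r S n))"

definition is_natural_boundary :: "complex fps \<Rightarrow> complex set \<Rightarrow> bool" where
  "is_natural_boundary F C \<longleftrightarrow>
     (\<exists>R>0. fps_conv_radius F = ereal R \<and> C = sphere 0 R \<and>
        \<not> (\<exists>U g. open U \<and> connected U \<and> ball 0 R \<subset> U \<and> g holomorphic_on U \<and>
                 (\<forall>z\<in>ball 0 R. g z = eval_fps F z)))"

lemma finite_padic_abs_neq_1: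
  assumes "x \<noteq> 0" and "\<And>p. p \<in> S \<Longrightarrow> prime p"
  shows "finite {p \<in> S. padic_abs p x \<noteq> 1}"
proof -
  obtain a b where ab: "quotient_of x = (a, b)" by (cases "quotient_of x")
  have b: "b > 0" using ab quotient_of_denom_pos by blast
  have a: "a \<noteq> 0" using quotient_of_div[OF ab] assms(1) by (cases "a = 0") simp_all
  have "p \<in> nat ` {q. q dvd a * b}" if "p \<in> S" "padic_abs p x \<noteq> 1" for p
  proof -
    have "int p dvd a * b"
    proof (rule ccontr)
      assume "\<not> int p dvd a * b"
      then have "multiplicity (int p) a = 0" "multiplicity (int p) b = 0"
        by (auto intro!: not_dvd_imp_multiplicity_0)
      then show False using that assms(1) ab by (simp add: padic_abs_def)
    qed
    then show ?thesis by (intro image_eqI[of _ _ "int p"]) auto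
  qed
  moreover have "finite {q::int. q dvd a * b}" using a b by (intro finite_divisors_int) auto
  ultimately show ?thesis by (intro finite_subset[OF _ finite_imageI[of _ nat]]) auto
qed

end

theory Submission
  imports "HOL-Number_Theory.Residues" Defs "Jordan_Normal_Form.Determinant"
begin

text \<open>
  By the product formula \<open>f_S r S n\<close> is the prime-to-\<open>S\<close> part of the numerator of \<open>r ^ n - 1\<close>, so
  \<open>F_S\<close> has integer coefficients \<open>a n\<close>, and the argument of Polya and Carlson applies. Suppose \<open>F_S\<close>
  continues to \<open>g\<close> on a larger connected open set \<open>U\<close>, which then contains a point of the circle.
  There is a holomorphic \<open>\<phi>\<close> mapping the closed unit disc into \<open>U\<close> with \<open>\<phi> 0 = 0\<close> and
  \<open>\<bar>\<phi>' 0\<bar> > 1\<close>. Substituting \<open>x = \<phi> u\<close>, \<open>y = \<phi> v\<close> in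
  \<open>(x g(x) - y g(y)) / (x - y) = \<Sum> a (i + j) x ^ i y ^ j\<close> gives a double series with bounded
  coefficients and multiplies the \<open>n\<close>-th Hankel determinant of \<open>a\<close> by \<open>\<phi>' 0 ^ (n * (n - 1))\<close>.
  Hence the determinants tend to \<open>0\<close>, vanish eventually, and \<open>a\<close> satisfies a linear recurrence.

  For a recurrence of minimal order the Hankel determinants of that order are nonzero integers
  growing like a geometric sequence, and radius of convergence \<open>1\<close> forces the ratio to have modulus
  \<open>1\<close>. By Cramer's rule and the pigeonhole principle \<open>a\<close> is eventually periodic modulo every integer.
  Let \<open>Z\<close> be the value at index \<open>0\<close> obtained by running the recurrence backwards. For a prime
  \<open>p \<notin> S\<close> the terms \<open>a n\<close> tend \<open>p\<close>-adically to \<open>0\<close> along suitable multiples of every period, so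
  \<open>Z = 0\<close>; then for a prime \<open>s \<in> S\<close> periodicity yields some \<open>n > 0\<close> with \<open>s dvd a n\<close>, which is
  impossible.
\<close>

subsection \<open>Hankel determinants and linear recurrences\<close>

text \<open>The polynomial ring acts on sequences with the indeterminate as left shift. Vanishing
  for all \<open>k\<close> is the linear recurrence with characteristic polynomial \<open>p\<close>,
  so recurrences can be divided and commuted like polynomials.\<close>

definition shift_act :: "(nat \<Rightarrow> 'a) \<Rightarrow> 'a poly \<Rightarrow> nat \<Rightarrow> 'a::comm_ring_1" where
  "shift_act a p k = (\<Sum>i\<le>degree p. coeff p i * a (k + i))"

definition hankel :: "(nat \<Rightarrow> 'a) \<Rightarrow> nat \<Rightarrow> nat \<Rightarrow> 'a mat" where
  "hankel a m n = mat n n (\<lambda>(i, j). a (m + i + j))"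

lemma hankel_carrier [simp]: "hankel a m n \<in> carrier_mat n n"
  by (simp add: hankel_def)

section \<open>The module laws of the shift action\<close>

lemma shift_act_eq_sum:
  assumes "\<And>i. n \<le> i \<Longrightarrow> coeff p i = 0"
  shows "shift_act a p k = (\<Sum>i<n. coeff p i * a (k + i))"
proof -
  have "(\<Sum>i<n. coeff p i * a (k + i)) = (\<Sum>i\<in>{..degree p} \<inter> {..<n}. coeff p i * a (k + i))"
    by (rule sum.mono_neutral_right) (auto intro: le_degree)
  also have "\<dots> = shift_act a p k"
    unfolding shift_act_def by (rule sum.mono_neutral_left) (auto simp: assms not_less)
  finally show ?thesis by simp
qed

lemma shift_act_0 [simp]: "shift_act a 0 k = 0"
  by (simp add: shift_act_def)

lemma shift_act_pCons: "shift_act a (pCons c p) k = c * a k + shift_act a p (Suc k)"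
proof -
  have "shift_act a (pCons c p) k = (\<Sum>i<Suc (Suc (degree p)). coeff (pCons c p) i * a (k + i))"
    by (rule shift_act_eq_sum) (auto simp: coeff_pCons coeff_eq_0 split: nat.splits)
  also have "\<dots> = c * a k + (\<Sum>i<Suc (degree p). coeff p i * a (Suc k + i))"
    by (subst sum.lessThan_Suc_shift) simp
  also have "(\<Sum>i<Suc (degree p). coeff p i * a (Suc k + i)) = shift_act a p (Suc k)"
    by (rule shift_act_eq_sum [symmetric]) (auto simp: coeff_eq_0)
  finally show ?thesis .
qed

lemma shift_act_add: "shift_act a (p + q) k = shift_act a p k + shift_act a q k"
proof -
  define n where "n = Suc (max (degree p) (degree q))"
  have "shift_act a r k = (\<Sum>i<n. coeff r i * a (k + i))" if "r \<in> {p, q, p + q}" for r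
    using that degree_add_le_max[of p q]
    by (intro shift_act_eq_sum coeff_eq_0) (auto simp: n_def)
  then show ?thesis by (simp add: sum.distrib distrib_right)
qed

lemma shift_act_smult: "shift_act a (Polynomial.smult c p) k = c * shift_act a p k"
proof -
  have "shift_act a (Polynomial.smult c p) k = (\<Sum>i<Suc (degree p). coeff (Polynomial.smult c p) i * a (k + i))"
    by (rule shift_act_eq_sum) (simp add: coeff_eq_0)
  then show ?thesis
    by (simp add: shift_act_def lessThan_Suc_atMost sum_distrib_left mult.assoc distrib_left)
qed

lemma shift_act_mult: "shift_act a (p * q) k = shift_act (shift_act a q) p k"
proof (induction p arbitrary: k)
  case (pCons c p)
  then show ?case by (simp add: mult_pCons_left shift_act_add shift_act_smult shift_act_pCons)
qed simp

text \<open>A kernel vector, read as the coefficients of a polynomial, turns the matrix-vector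
  product into \<open>n\<close> consecutive values of the shift action.\<close>

lemma det_hankel_eq_0_iff:
  fixes a :: "nat \<Rightarrow> 'a::field"
  shows "det (hankel a m n) = 0 \<longleftrightarrow>
    (\<exists>p. p \<noteq> 0 \<and> (\<forall>i\<ge>n. coeff p i = 0) \<and> (\<forall>i<n. shift_act a p (m + i) = 0))"
proof -
  have mv: "vec_index (hankel a m n *\<^sub>v v) i = shift_act a p (m + i)"
    if v: "v \<in> carrier_vec n" and p: "\<And>j. coeff p j = (if j < n then vec_index v j else 0)"
      and "i < n" for v p i
  proof -
    have "vec_index (hankel a m n *\<^sub>v v) i = (\<Sum>j<n. a (m + i + j) * vec_index v j)"
      using that by (simp add: hankel_def scalar_prod_def lessThan_atLeast0)
    also have "\<dots> = (\<Sum>j<n. coeff p j * a (m + i + j))"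
      by (intro sum.cong) (auto simp: p)
    also have "\<dots> = shift_act a p (m + i)"
      by (rule shift_act_eq_sum [symmetric]) (simp add: p)
    finally show ?thesis .
  qed
  show ?thesis
  proof
    assume "det (hankel a m n) = 0"
    then obtain v where v: "v \<in> carrier_vec n" "v \<noteq> 0\<^sub>v n" "hankel a m n *\<^sub>v v = 0\<^sub>v n"
      using det_0_iff_vec_prod_zero_field[OF hankel_carrier] by blast
    define p where "p = (\<Sum>j<n. monom (vec_index v j) j)"
    have p: "coeff p j = (if j < n then vec_index v j else 0)" for j
      by (simp add: p_def coeff_sum)
    have "p \<noteq> 0"
    proof
      assume "p = 0"
      with p have "vec_index v j = 0" if "j < n" for j using that by (metis coeff_0)
      then show False using v by (auto intro: eq_vecI)
    qed
    moreover have "shift_act a p (m + i) = 0" if "i < n" for i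
      using mv[OF v(1) p that] v(3) that by simp
    ultimately show "\<exists>p. p \<noteq> 0 \<and> (\<forall>i\<ge>n. coeff p i = 0) \<and> (\<forall>i<n. shift_act a p (m + i) = 0)"
      using p by (intro exI[of _ p]) auto
  next
    assume "\<exists>p. p \<noteq> 0 \<and> (\<forall>i\<ge>n. coeff p i = 0) \<and> (\<forall>i<n. shift_act a p (m + i) = 0)"
    then obtain p where p: "p \<noteq> 0" "\<And>i. i \<ge> n \<Longrightarrow> coeff p i = 0"
      "\<And>i. i < n \<Longrightarrow> shift_act a p (m + i) = 0" by blast
    define v where "v = vec n (coeff p)"
    have v: "v \<in> carrier_vec n" by (simp add: v_def)
    have pv: "coeff p j = (if j < n then vec_index v j else 0)" for j
      using p(2) by (simp add: v_def)
    have "v \<noteq> 0\<^sub>v n"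
    proof
      assume "v = 0\<^sub>v n"
      then have "coeff p j = 0" for j using pv[of j] by simp
      then show False using p(1) by (simp add: poly_eq_iff)
    qed
    moreover have "hankel a m n *\<^sub>v v = 0\<^sub>v n"
      using mv[OF v pv] p(3) by (intro eq_vecI) (auto simp: hankel_def)
    ultimately show "det (hankel a m n) = 0"
      using det_0_iff_vec_prod_zero_field[OF hankel_carrier] v by blast
  qed
qed

text \<open>Kronecker's criterion. Let \<open>d\<close> be the largest size with nonzero
  determinant; the kernel polynomial \<open>v\<close> of size \<open>d + 1\<close> is the
  recurrence. If it first failed at \<open>m\<close>, a kernel polynomial of size
  \<open>m + 1\<close> would be a multiple of \<open>v\<close> and would detect the failure.\<close>

lemma eventually_zero_hankel_imp_recurrence:
  fixes a :: "nat \<Rightarrow> 'a::field"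
  assumes "\<And>n. n \<ge> n0 \<Longrightarrow> det (hankel a 0 n) = 0"
  obtains v where "v \<noteq> 0" "\<And>k. shift_act a v k = 0"
proof -
  define n1 where "n1 = (LEAST n. \<forall>m\<ge>n. det (hankel a 0 m) = 0)"
  have n1: "\<And>m. m \<ge> n1 \<Longrightarrow> det (hankel a 0 m) = 0"
    using LeastI[of "\<lambda>n. \<forall>m\<ge>n. det (hankel a 0 m) = 0" n0] assms unfolding n1_def by blast
  \<comment> \<open>The empty determinant is 1.\<close>
  have "n1 \<noteq> 0"
    using n1[of 0] det_dim_zero[of "hankel a 0 0"] by auto
  then obtain d where d: "n1 = Suc d" by (cases n1) auto
  have Hd: "det (hankel a 0 d) \<noteq> 0"
  proof
    assume *: "det (hankel a 0 d) = 0"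
    have "\<forall>m\<ge>d. det (hankel a 0 m) = 0"
      using * n1 d by (metis Suc_leI le_neq_implies_less)
    then have "n1 \<le> d" unfolding n1_def by (rule Least_le)
    then show False using d by simp
  qed
  have nonsing: "p = 0" if "\<And>i. i \<ge> d \<Longrightarrow> coeff p i = 0" "\<And>i. i < d \<Longrightarrow> shift_act a p i = 0" for p
    using Hd that det_hankel_eq_0_iff[of a 0 d] by auto
  have "det (hankel a 0 (Suc d)) = 0" using n1 d by simp
  then obtain v where v: "v \<noteq> 0" "\<And>i. i \<ge> Suc d \<Longrightarrow> coeff v i = 0"
    "\<And>i. i < Suc d \<Longrightarrow> shift_act a v i = 0"
    using det_hankel_eq_0_iff[of a 0 "Suc d"] by auto
  have "degree v = d"
  proof (rule ccontr)
    assume *: "degree v \<noteq> d"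
    have "degree v \<le> d" using v(2) by (intro degree_le) auto
    with * have "coeff v i = 0" if "i \<ge> d" for i using that by (simp add: coeff_eq_0)
    with nonsing[of v] v show False by simp
  qed
  define b where "b = shift_act a v"
  have "b k = 0" for k
  proof (rule ccontr)
    assume "b k \<noteq> 0"
    define m where "m = (LEAST k. b k \<noteq> 0)"
    have bm: "b m \<noteq> 0" unfolding m_def by (rule LeastI) fact
    have b0: "b k = 0" if "k < m" for k using that not_less_Least unfolding m_def by blast
    have md: "m > d" using v(3) bm by (metis b_def not_less_eq)
    have "det (hankel a 0 (Suc m)) = 0" using n1 d md by simp
    then obtain x where x: "x \<noteq> 0" "\<And>i. i \<ge> Suc m \<Longrightarrow> coeff x i = 0"
      "\<And>i. i < Suc m \<Longrightarrow> shift_act a x i = 0"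
      using det_hankel_eq_0_iff[of a 0 "Suc m"] by auto
    define q r where "q = x div v" and "r = x mod v"
    have xqr: "x = q * v + r" by (simp add: q_def r_def)
    have r: "coeff r i = 0" if "i \<ge> d" for i
      using degree_mod_less[OF v(1), of x] that \<open>degree v = d\<close>
      by (auto simp: r_def coeff_eq_0)
    have dq: "degree q \<le> m - d"
    proof (rule ccontr)
      assume *: "\<not> degree q \<le> m - d"
      then have "degree (q * v) = degree q + d"
        using v(1) \<open>degree v = d\<close> by (subst degree_mult_eq) auto
      then have "coeff x (degree q + d) = lead_coeff (q * v)"
        using r[of "degree q + d"] by (simp add: xqr)
      moreover have "q * v \<noteq> 0" using v(1) * by auto
      ultimately show False using x(2)[of "degree q + d"] * md by (simp del: lead_coeff_mult add: not_le)
    qed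
    have qv: "shift_act a (q * v) i = (\<Sum>j\<le>degree q. coeff q j * b (i + j))" for i
      by (simp add: shift_act_mult b_def[symmetric] shift_act_def[of b])
    \<comment> \<open>Only values of \<open>b\<close> before \<open>m\<close> enter the multiple
      \<open>q * v\<close>, so the remainder \<open>r\<close> lies in the kernel of the nonsingular
      matrix of size \<open>d\<close>.\<close>
    have "shift_act a r i = 0" if "i < d" for i
    proof -
      have "shift_act a (q * v) i = 0"
        unfolding qv using that dq md by (intro sum.neutral ballI) (auto intro!: b0)
      then show ?thesis using x(3)[of i] that md by (simp add: xqr shift_act_add)
    qed
    with r nonsing have "r = 0" by blast
    then have "q \<noteq> 0" using x(1) xqr by auto
    \<comment> \<open>At this index the leading coefficient of \<open>q\<close> meets
      \<open>b m\<close>, and all other coefficients meet earlier values, which are 0.\<close>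
    have "0 = shift_act a (q * v) (m - degree q)"
      using x(3)[of "m - degree q"] xqr \<open>r = 0\<close> by simp
    also have "\<dots> = (\<Sum>j\<in>{degree q}. coeff q j * b (m - degree q + j))"
      unfolding qv using dq md by (intro sum.mono_neutral_right) (auto intro!: b0)
    also have "\<dots> = lead_coeff q * b m" using dq by simp
    finally show False using bm \<open>q \<noteq> 0\<close> by simp
  qed
  then show ?thesis using that v(1) by (simp add: b_def)
qed

text \<open>Leibniz expansion. The factor \<open>fact n\<close> is harmless: the bound is applied at
  fixed size or against a factor growing like \<alpha> to the power
  \<open>n * (n - 1)\<close>.\<close>

lemma norm_det_le:
  fixes A :: "'a::real_normed_field mat"
  assumes A: "A \<in> carrier_mat n n"
    and B: "\<And>i j. i < n \<Longrightarrow> j < n \<Longrightarrow> norm (A $$ (i, j)) \<le> B"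
  shows "norm (det A) \<le> fact n * B ^ n"
proof -
  have "norm (det A) \<le> (\<Sum>p | p permutes {0..<n}. norm (signof p * (\<Prod>i=0..<n. A $$ (i, p i))))"
    unfolding det_def'[OF A] by (rule norm_sum)
  also have "\<dots> \<le> (\<Sum>p | p permutes {0..<n}. B ^ n)"
  proof (rule sum_mono)
    fix p assume "p \<in> {p. p permutes {0..<n}}"
    then have p: "p permutes {0..<n}" by simp
    have "norm (signof p * (\<Prod>i=0..<n. A $$ (i, p i))) = (\<Prod>i=0..<n. norm (A $$ (i, p i)))"
      by (simp add: norm_mult prod_norm sign_def)
    also have "\<dots> \<le> (\<Prod>i=0..<n. B)"
      using permutes_in_image[OF p] by (intro prod_mono) (auto intro!: B)
    finally show "norm (signof p * (\<Prod>i=0..<n. A $$ (i, p i))) \<le> B ^ n" by simp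
  qed
  also have "\<dots> = fact n * B ^ n"
    by (simp add: card_permutations)
  finally show ?thesis .
qed

section \<open>Recurrences of minimal order and their Hankel determinants\<close>

lemma recurrence_eq_0:
  fixes a :: "nat \<Rightarrow> 'a::field"
  assumes "v \<noteq> 0" "\<And>k. shift_act a v k = 0" "\<And>l. l < degree v \<Longrightarrow> a l = 0"
  shows "a l = 0"
proof (induction l rule: less_induct)
  case (less l)
  show ?case
  proof (cases "l < degree v")
    case False
    have "0 = shift_act a v (l - degree v)" by (simp add: assms)
    also have "\<dots> = (\<Sum>i\<in>{degree v}. coeff v i * a (l - degree v + i))"
      unfolding shift_act_def using False
      by (intro sum.mono_neutral_right) (auto intro!: less)
    also have "\<dots> = lead_coeff v * a l" using False by simp
    finally show ?thesis using assms(1) by simp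
  qed (use assms in auto)
qed

lemma shift_act_shift: "shift_act (\<lambda>n. a (m + n)) v k = shift_act a v (m + k)"
  by (simp add: shift_act_def add.assoc)

text \<open>Take \<open>v\<close> of least degree among the nonzero polynomials annihilating some
  tail of \<open>a\<close>. Working with tails permits division by the indeterminate, hence the
  nonzero constant coefficient. A singular window would give a smaller degree.\<close>

lemma minimal_recurrence:
  fixes a :: "nat \<Rightarrow> 'a::field"
  assumes "v0 \<noteq> 0" "\<And>k. shift_act a v0 k = 0"
  obtains v t where "coeff v 0 \<noteq> 0" "\<And>k. k \<ge> t \<Longrightarrow> shift_act a v k = 0"
    "\<And>m. m \<ge> t \<Longrightarrow> det (hankel a m (degree v)) \<noteq> 0"
proof -
  define Q where "Q v \<longleftrightarrow> v \<noteq> 0 \<and> (\<exists>t. \<forall>k\<ge>t. shift_act a v k = 0)" for v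
  have "Q v0" using assms by (auto simp: Q_def)
  then obtain v where v: "Q v" "\<And>u. Q u \<Longrightarrow> degree v \<le> degree u"
    using ex_has_least_nat[of Q v0 degree] by blast
  then obtain t where t: "\<And>k. k \<ge> t \<Longrightarrow> shift_act a v k = 0" and "v \<noteq> 0"
    by (auto simp: Q_def)
  show thesis
  proof
    show "coeff v 0 \<noteq> 0"
    proof
      assume *: "coeff v 0 = 0"
      obtain c u where vu: "v = pCons c u" by (cases v)
      then have "v = pCons 0 u" using * by simp
      then have "u \<noteq> 0" using \<open>v \<noteq> 0\<close> by auto
      have "shift_act a u k = 0" if "k \<ge> Suc t" for k
        using t[of "k - 1"] that \<open>v = pCons 0 u\<close> by (simp add: shift_act_pCons)
      then have "Q u" using \<open>u \<noteq> 0\<close> by (auto simp: Q_def)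
      then show False using v(2)[of u] \<open>v = pCons 0 u\<close> \<open>u \<noteq> 0\<close> by simp
    qed
    show "shift_act a v k = 0" if "k \<ge> t" for k by (rule t) fact
    show "det (hankel a m (degree v)) \<noteq> 0" if "m \<ge> t" for m
    proof
      assume "det (hankel a m (degree v)) = 0"
      then obtain u where u: "u \<noteq> 0" "\<And>i. i \<ge> degree v \<Longrightarrow> coeff u i = 0"
        "\<And>i. i < degree v \<Longrightarrow> shift_act a u (m + i) = 0"
        unfolding det_hankel_eq_0_iff by blast
      define b where "b = (\<lambda>n. shift_act a u (m + n))"
      \<comment> \<open>The actions of \<open>u\<close> and \<open>v\<close> commute, so
        \<open>b\<close> inherits the recurrence \<open>v\<close>; as it starts with
        \<open>degree v\<close> zeros, it vanishes.\<close>
      have "shift_act b v k = 0" for k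
      proof -
        have "shift_act b v k = shift_act (shift_act a u) v (m + k)"
          unfolding b_def by (rule shift_act_shift)
        also have "\<dots> = shift_act (shift_act a v) u (m + k)"
          by (metis shift_act_mult mult.commute)
        also have "\<dots> = 0" unfolding shift_act_def[of "shift_act a v"] using that
          by (intro sum.neutral) (auto intro!: t)
        finally show ?thesis .
      qed
      then have "b l = 0" for l
        using recurrence_eq_0[OF \<open>v \<noteq> 0\<close>, of b] u(3) by (auto simp: b_def)
      then have "shift_act a u k = 0" if "k \<ge> m" for k
        using that by (metis b_def le_add_diff_inverse)
      then have "Q u" using u(1) by (auto simp: Q_def)
      moreover have "degree u < degree v"
        using v(2)[OF \<open>Q u\<close>] u(1) u(2)[of "degree u"] by (meson leI leading_coeff_0_iff)
      ultimately show False using v(2)[OF \<open>Q u\<close>] by simp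
    qed
  qed
qed

text \<open>Multiplication by the companion matrix of \<open>v\<close> moves the window by one, so
  the ratio is the determinant of that matrix.\<close>

lemma det_hankel_Suc:
  fixes a :: "nat \<Rightarrow> 'a::field"
  assumes "v \<noteq> 0" "\<And>k. k \<ge> t \<Longrightarrow> shift_act a v k = 0"
  shows "\<exists>c. \<forall>m\<ge>t. det (hankel a (Suc m) (degree v)) = c * det (hankel a m (degree v))"
proof -
  define d where "d = degree v"
  define C where "C = mat d d (\<lambda>(i, j). if Suc i < d then (if j = Suc i then 1 else 0)
    else - coeff v j / lead_coeff v)"
  have C: "C \<in> carrier_mat d d" by (simp add: C_def)
  have "C * hankel a m d = hankel a (Suc m) d" if "m \<ge> t" for m
  proof (rule eq_matI)
    fix i j assume "i < dim_row (hankel a (Suc m) d)" "j < dim_col (hankel a (Suc m) d)"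
    then have ij: "i < d" "j < d" by (auto simp: hankel_def)
    have "(C * hankel a m d) $$ (i, j) = (\<Sum>l<d. C $$ (i, l) * a (m + l + j))"
      using ij C by (simp add: hankel_def scalar_prod_def lessThan_atLeast0)
    also have "\<dots> = a (Suc m + i + j)"
    proof (cases "Suc i < d")
      case True
      then have "(\<Sum>l<d. C $$ (i, l) * a (m + l + j)) = (\<Sum>l\<in>{Suc i}. a (m + l + j))"
        by (intro sum.mono_neutral_cong_right) (auto simp: C_def)
      then show ?thesis by simp
    next
      case False
      then have "(\<Sum>l<d. C $$ (i, l) * a (m + l + j))
          = - (\<Sum>l<d. coeff v l * a (m + j + l)) / lead_coeff v"
        using ij by (simp add: C_def sum_negf sum_divide_distrib add_ac flip: sum_negf)
      moreover have "(\<Sum>l<d. coeff v l * a (m + j + l)) + lead_coeff v * a (m + j + d) = 0"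
        using assms(2)[of "m + j"] that
        by (simp add: shift_act_def d_def flip: lessThan_Suc_atMost)
      then have "- (\<Sum>l<d. coeff v l * a (m + j + l)) = lead_coeff v * a (m + j + d)"
        by (rule minus_unique)
      moreover have "Suc i = d" using False ij by simp
      then have "m + j + d = Suc m + i + j" by simp
      ultimately show ?thesis using assms(1) by simp
    qed
    also have "\<dots> = hankel a (Suc m) d $$ (i, j)" using ij by (simp add: hankel_def)
    finally show "(C * hankel a m d) $$ (i, j) = hankel a (Suc m) d $$ (i, j)" .
  qed (auto simp: C_def hankel_def)
  then have "det (hankel a (Suc m) d) = det C * det (hankel a m d)" if "m \<ge> t" for m
    using that det_mult[OF C hankel_carrier] by metis
  then show ?thesis unfolding d_def by blast
qed

lemma det_hankel_of_int:
  "det (hankel (\<lambda>n. of_int (a n) :: 'a::comm_ring_1) m n) = of_int (det (hankel a m n))"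
proof -
  have "hankel (\<lambda>n. of_int (a n) :: 'a) m n = map_mat of_int (hankel a m n)"
    by (rule eq_matI) (auto simp: hankel_def)
  then show ?thesis by (simp add: of_int_hom.hom_det)
qed

subsection \<open>Recurrent integer sequences of subexponential growth\<close>

text \<open>The determinants form a geometric sequence of nonzero integers. A ratio of modulus below
  1 would bring them below 1; a ratio of modulus above 1 contradicts the subexponential growth of
  \<open>a\<close>.\<close>

lemma abs_det_hankel_const:
  fixes a :: "nat \<Rightarrow> int" and v :: "rat poly"
  assumes "v \<noteq> 0" and rec: "\<And>k. k \<ge> t \<Longrightarrow> shift_act (\<lambda>n. of_int (a n)) v k = 0"
    and nz: "\<And>m. m \<ge> t \<Longrightarrow> det (hankel a m (degree v)) \<noteq> 0"
    and growth: "\<And>x::real. x > 1 \<Longrightarrow> \<exists>C. \<forall>n. \<bar>of_int (a n)\<bar> \<le> C * x ^ n"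
    and "m \<ge> t"
  shows "\<bar>det (hankel a m (degree v))\<bar> = \<bar>det (hankel a t (degree v))\<bar>"
proof -
  define d where "d = degree v"
  define D where "D m = \<bar>real_of_int (det (hankel a m d))\<bar>" for m
  obtain c where "\<forall>m\<ge>t. det (hankel (\<lambda>n. rat_of_int (a n)) (Suc m) (degree v))
      = c * det (hankel (\<lambda>n. rat_of_int (a n)) m (degree v))"
    using det_hankel_Suc[OF assms(1) rec] by blast
  then have c: "rat_of_int (det (hankel a (Suc m) d)) = c * rat_of_int (det (hankel a m d))"
    if "m \<ge> t" for m using that by (simp only: det_hankel_of_int d_def)
  define x where "x = \<bar>real_of_rat c\<bar>"
  have D_Suc: "D (Suc m) = x * D m" if "m \<ge> t" for m
  proof -
    have "real_of_rat (of_int (det (hankel a (Suc m) d)))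
        = real_of_rat c * real_of_rat (of_int (det (hankel a m d)))"
      by (simp only: c[OF that] of_rat_mult)
    then show ?thesis by (simp add: D_def x_def abs_mult)
  qed
  have D_add: "D (t + k) = D t * x ^ k" for k
    by (induction k) (simp_all add: D_Suc)
  have D1: "D m \<ge> 1" if "m \<ge> t" for m
    using nz[OF that] unfolding D_def d_def by linarith
  have "x = 1"
  proof (rule ccontr)
    assume "x \<noteq> 1"
    moreover have "x \<ge> 0" by (simp add: x_def)
    ultimately consider "0 \<le> x" "x < 1" | "x > 1" by linarith
    then show False
    proof cases
      case 1
      have "(\<lambda>k. D t * x ^ k) \<longlonglongrightarrow> D t * 0"
        using 1 by (intro tendsto_intros LIMSEQ_realpow_zero)
      then have "\<forall>\<^sub>F k in sequentially. D t * x ^ k < 1"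
        by (rule order_tendstoD) simp
      then obtain k where "D t * x ^ k < 1" by (auto simp: eventually_sequentially)
      then show False using D1[of "t + k"] D_add[of k] by simp
    next
      case 2
      \<comment> \<open>Entries of order \<open>y ^ k\<close> give determinants of order
        \<open>y ^ (d * k)\<close>, whereas \<open>x ^ k = y ^ (Suc d * k)\<close>; the surplus
        \<open>y ^ k\<close> is unbounded.\<close>
      define y where "y = root (Suc d) x"
      have y: "y > 1" "y ^ Suc d = x" using 2 by (auto simp: y_def simp del: power_Suc)
      obtain C where C: "\<And>n. \<bar>of_int (a n)\<bar> \<le> C * y ^ n" using growth[OF y(1)] by blast
      have "C \<ge> 0" using C[of 0] by simp
      define K where "K = fact d * (C * y ^ (t + 2 * d)) ^ d"
      have bound: "D t * y ^ k \<le> K" for k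
      proof -
        have "D (t + k) = norm (det (hankel (\<lambda>n. real_of_int (a n)) (t + k) d))"
          by (simp add: D_def det_hankel_of_int)
        also have "\<dots> \<le> fact d * (C * y ^ (t + 2 * d) * y ^ k) ^ d"
        proof (rule norm_det_le[OF hankel_carrier])
          fix i j assume "i < d" "j < d"
          then have "norm (hankel (\<lambda>n. real_of_int (a n)) (t + k) d $$ (i, j))
              = \<bar>of_int (a (t + k + i + j))\<bar>" by (simp add: hankel_def)
          also have "\<dots> \<le> C * y ^ (t + k + i + j)" by (rule C)
          also have "\<dots> \<le> C * y ^ (t + 2 * d + k)"
            using y \<open>C \<ge> 0\<close> \<open>i < d\<close> \<open>j < d\<close> by (intro mult_left_mono power_increasing) auto
          finally show "norm (hankel (\<lambda>n. real_of_int (a n)) (t + k) d $$ (i, j))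
              \<le> C * y ^ (t + 2 * d) * y ^ k" by (simp add: power_add mult_ac)
        qed
        also have "\<dots> = K * y ^ (d * k)"
          by (simp add: K_def power_mult_distrib flip: power_mult) (simp add: mult_ac)
        finally have "D t * y ^ (Suc d * k) \<le> K * y ^ (d * k)"
          by (simp add: D_add y(2)[symmetric] flip: power_mult power_Suc)
        then have "(D t * y ^ k) * y ^ (d * k) \<le> K * y ^ (d * k)"
          by (simp add: power_add mult_ac)
        then show ?thesis using y by simp
      qed
      obtain k where "K < y ^ k" using real_arch_pow[OF y(1)] by blast
      moreover have "1 * y ^ k \<le> D t * y ^ k" using D1[of t] y by (intro mult_right_mono) auto
      ultimately show False using bound[of k] by simp
    qed
  qed
  then have "D m = D t" using D_add[of "m - t"] \<open>m \<ge> t\<close> by simp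
  then show ?thesis by (simp add: D_def d_def flip: of_int_abs)
qed

text \<open>Pigeonhole gives two windows congruent modulo \<open>D * N\<close>. By Cramer's rule
  \<open>det H * a (n + l)\<close> is an integer combination of the \<open>a (m + i + l)\<close>
  with coefficients independent of \<open>l\<close>. Comparing \<open>l = P\<close> with
  \<open>l = 0\<close> carries the congruence to every \<open>n\<close>, and cancelling
  \<open>D\<close> leaves the modulus \<open>N\<close>.\<close>

lemma recurrence_imp_periodic_mod:
  fixes a :: "nat \<Rightarrow> int" and v :: "rat poly"
  assumes "v \<noteq> 0" and rec: "\<And>k. k \<ge> t \<Longrightarrow> shift_act (\<lambda>n. of_int (a n)) v k = 0"
    and nz: "\<And>m. m \<ge> t \<Longrightarrow> det (hankel a m (degree v)) \<noteq> 0"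
    and D: "\<And>m. m \<ge> t \<Longrightarrow> \<bar>det (hankel a m (degree v))\<bar> = D"
    and "N > 0"
  obtains P where "P > 0" "\<And>n. n \<ge> t \<Longrightarrow> N dvd a (n + P) - a n"
proof -
  define d where "d = degree v"
  have "D > 0" using nz[of t] D[of t] by auto
  define f where "f m = map (\<lambda>i. a (m + i) mod (D * N)) [0..<d]" for m
  have "f ` {t..} \<subseteq> {xs. set xs \<subseteq> {0..<D * N} \<and> length xs = d}"
    using \<open>D > 0\<close> \<open>N > 0\<close> by (auto simp: f_def)
  then have "finite (f ` {t..})"
    by (rule finite_subset) (auto intro: finite_lists_length_eq)
  then obtain m where m: "m \<ge> t" "infinite {m' \<in> {t..}. f m' = f m}"
    using pigeonhole_infinite[of "{t..}" f] infinite_Ici by auto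
  then obtain m' where m': "m' > m" "f m' = f m"
    by (metis (mono_tags, lifting) infinite_nat_iff_unbounded mem_Collect_eq)
  define P where "P = m' - m"
  have cong: "D * N dvd a (m' + i) - a (m + i)" if "i < d" for i
  proof -
    have "f m' ! i = f m ! i" using m' by simp
    then show ?thesis using that by (simp add: f_def mod_eq_dvd_iff)
  qed
  show thesis
  proof
    show "P > 0" using m' by (simp add: P_def)
    fix n assume "n \<ge> t"
    define H where "H = hankel a m d"
    define b where "b = vec d (\<lambda>l. a (n + l))"
    define y where "y = adj_mat H *\<^sub>v b"
    have Hc: "H \<in> carrier_mat d d" and bc: "b \<in> carrier_vec d" by (simp_all add: H_def b_def)
    have adj: "adj_mat H \<in> carrier_mat d d" "H * adj_mat H = det H \<cdot>\<^sub>m 1\<^sub>m d"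
      using adj_mat[OF Hc] by auto
    have yc: "y \<in> carrier_vec d" using adj(1) bc by (simp add: y_def)
    have "H *\<^sub>v y = (H * adj_mat H) *\<^sub>v b"
      unfolding y_def using Hc adj(1) bc by (simp add: assoc_mult_mat_vec[of _ d d _ d])
    also have "\<dots> = det H \<cdot>\<^sub>v b"
      using bc by (intro eq_vecI) (auto simp: adj(2))
    finally have Hy: "H *\<^sub>v y = det H \<cdot>\<^sub>v b" .
    \<comment> \<open>The error in Cramer's formula is 0 at the first \<open>d\<close> arguments and
      satisfies the recurrence \<open>v\<close>, so it vanishes everywhere.\<close>
    define e where "e l = (\<Sum>i<d. vec_index y i * a (m + i + l)) - det H * a (n + l)" for l
    have e0: "e l = 0" if "l < d" for l
    proof -
      have "vec_index (H *\<^sub>v y) l = (\<Sum>i<d. a (m + l + i) * vec_index y i)"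
        using that yc by (simp add: H_def hankel_def scalar_prod_def lessThan_atLeast0)
      moreover have "vec_index (det H \<cdot>\<^sub>v b) l = det H * a (n + l)"
        using that by (simp add: b_def)
      ultimately show ?thesis by (simp add: e_def Hy add_ac mult_ac)
    qed
    have "shift_act (\<lambda>l. rat_of_int (e l)) v k = 0" for k
    proof -
      have "shift_act (\<lambda>l. rat_of_int (e l)) v k =
          (\<Sum>i<d. of_int (vec_index y i) * shift_act (\<lambda>n. of_int (a n)) v (m + i + k))
          - of_int (det H) * shift_act (\<lambda>n. of_int (a n)) v (n + k)"
      proof -
        have "(\<Sum>j\<le>degree v. \<Sum>i<d. coeff v j * (of_int (vec_index y i) * of_int (a (m + i + (k + j)))))
            = (\<Sum>i<d. \<Sum>j\<le>degree v. of_int (vec_index y i) * (coeff v j * of_int (a (m + i + k + j))))"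
          by (subst sum.swap) (simp add: mult_ac add_ac)
        moreover have "(\<Sum>j\<le>degree v. coeff v j * (of_int (det H) * of_int (a (n + (k + j)))))
            = (\<Sum>j\<le>degree v. of_int (det H) * (coeff v j * of_int (a (n + k + j))))"
          by (simp add: mult_ac add_ac)
        ultimately show ?thesis
          by (simp only: shift_act_def e_def of_int_diff of_int_sum of_int_mult
              right_diff_distrib sum_subtractf sum_distrib_left)
      qed
      also have "\<dots> = 0" using rec m(1) \<open>n \<ge> t\<close> by simp
      finally show ?thesis .
    qed
    then have "e l = 0" for l
      using recurrence_eq_0[OF assms(1), of "\<lambda>l. rat_of_int (e l)" l] e0 by (simp add: d_def)
    then have el: "det H * a (n + l) = (\<Sum>i<d. vec_index y i * a (m + i + l))" for l
      by (simp add: e_def)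
    have "det H * (a (n + P) - a n) = (\<Sum>i<d. vec_index y i * (a (m' + i) - a (m + i)))"
      using el[of P] el[of 0] m'(1)
      by (simp add: right_diff_distrib sum_subtractf P_def add_ac)
    moreover have "D * N dvd (\<Sum>i<d. vec_index y i * (a (m' + i) - a (m + i)))"
      using cong by (intro dvd_sum) auto
    ultimately have "D * N dvd det H * (a (n + P) - a n)" by simp
    moreover have "\<bar>det H\<bar> = D" using D m(1) by (simp add: H_def d_def)
    ultimately have "D * N dvd D * (a (n + P) - a n)"
      by (metis abs_dvd_iff abs_mult abs_of_pos \<open>D > 0\<close> dvd_abs_iff)
    then show "N dvd a (n + P) - a n" using \<open>D > 0\<close> by simp
  qed
qed

text \<open>For every modulus periodicity starts at the same \<open>t\<close>, so the value assigned
  backwards to index 0 can be compared with late terms. Powers of \<open>p\<close> force it to be 0,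
  and this yields a term divisible by \<open>s\<close>.\<close>

lemma eventually_zero_hankel_contradiction:
  fixes a :: "nat \<Rightarrow> int" and p s :: int
  assumes hankel: "\<And>n. n \<ge> n0 \<Longrightarrow> det (hankel a 0 n) = 0"
    and growth: "\<And>x::real. x > 1 \<Longrightarrow> \<exists>C. \<forall>n. \<bar>of_int (a n)\<bar> \<le> C * x ^ n"
    and p: "p > 1" "\<And>k. \<exists>Q>0. \<forall>j>0. p ^ k dvd a (j * Q)"
    and s: "s > 1" "\<And>n. n > 0 \<Longrightarrow> \<not> s dvd a n"
  shows False
proof -
  let ?a = "\<lambda>n. rat_of_int (a n)"
  have "det (hankel ?a 0 n) = 0" if "n \<ge> n0" for n
    using hankel[OF that] by (simp add: det_hankel_of_int)
  then obtain v0 where "v0 \<noteq> 0" "\<And>k. shift_act ?a v0 k = 0"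
    using eventually_zero_hankel_imp_recurrence[of n0 ?a] by blast
  then obtain v t where v: "coeff v 0 \<noteq> 0" and rec: "\<And>k. k \<ge> t \<Longrightarrow> shift_act ?a v k = 0"
    and "\<And>m. m \<ge> t \<Longrightarrow> det (hankel ?a m (degree v)) \<noteq> 0"
    using minimal_recurrence[of v0 ?a] by blast
  then have nz: "\<And>m. m \<ge> t \<Longrightarrow> det (hankel a m (degree v)) \<noteq> 0"
    by (simp add: det_hankel_of_int)
  have "v \<noteq> 0" using v by auto
  have periodic: "\<exists>P>0. \<forall>n\<ge>t. N dvd a (n + P) - a n" if "N > 0" for N :: int
  proof -
    have "\<bar>det (hankel a m (degree v))\<bar> = \<bar>det (hankel a t (degree v))\<bar>" if "m \<ge> t" for m
      by (rule abs_det_hankel_const) (use \<open>v \<noteq> 0\<close> rec nz growth that in blast)+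
    from recurrence_imp_periodic_mod[OF \<open>v \<noteq> 0\<close> rec nz this \<open>N > 0\<close>]
    show ?thesis by blast
  qed
  define d where "d = degree v"
  obtain w :: "nat \<Rightarrow> int" where w: "w 0 \<noteq> 0" "\<And>n. n \<ge> t \<Longrightarrow> (\<Sum>i\<le>d. w i * a (n + i)) = 0"
  proof -
    \<comment> \<open>A common denominator, giving integer coefficients \<open>w\<close>.\<close>
    define M where "M = (\<Prod>i\<le>d. snd (quotient_of (coeff v i)))"
    have "M \<noteq> 0" using quotient_of_denom_pos' by (auto simp: M_def less_le)
    have "\<exists>z. of_int z = of_int M * coeff v i" if "i \<le> d" for i
    proof -
      obtain x y where q: "quotient_of (coeff v i) = (x, y)" by (cases "quotient_of (coeff v i)")
      have "snd (quotient_of (coeff v i)) dvd M" unfolding M_def using that by (intro dvd_prodI) auto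
      then obtain m where "M = y * m" by (auto simp: q)
      moreover have "coeff v i = of_int x / of_int y" using quotient_of_div[OF q] .
      moreover have "y \<noteq> 0" using quotient_of_denom_pos[OF q] by simp
      ultimately have "of_int (m * x) = of_int M * coeff v i" by simp
      then show ?thesis by blast
    qed
    then obtain w where w: "\<And>i. i \<le> d \<Longrightarrow> rat_of_int (w i) = of_int M * coeff v i" by metis
    show thesis
    proof
      show "w 0 \<noteq> 0" using w[of 0] v \<open>M \<noteq> 0\<close> by auto
      fix n assume "n \<ge> t"
      have "rat_of_int (\<Sum>i\<le>d. w i * a (n + i)) = of_int M * shift_act ?a v n"
        by (simp add: w shift_act_def sum_distrib_left mult.assoc flip: d_def)
      then show "(\<Sum>i\<le>d. w i * a (n + i)) = 0" using rec[OF \<open>n \<ge> t\<close>] by (simp flip: of_int_sum of_int_mult)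
    qed
  qed
  \<comment> \<open>For \<open>n \<ge> t\<close> the rescaled sequence \<open>w 0 ^ T * a n\<close> is expressed by values of \<open>a\<close> beyond \<open>n + T\<close>;
    the same expression \<open>G T n\<close> makes sense, and stays periodic, for \<open>n \<ge> t - T\<close>, so \<open>G t 0\<close> is the
    rescaled value that the recurrence run backwards assigns to index \<open>0\<close>.\<close>
  define G where "G T = ((\<lambda>g n. - (\<Sum>i=1..d. w i * g (n + i))) ^^ T) a" for T
  have G_0: "G 0 = a" by (simp add: G_def)
  have G_Suc: "G (Suc T) n = - (\<Sum>i=1..d. w i * G T (n + i))" for T n
    by (simp add: G_def)
  have G_eq: "G T n = w 0 ^ T * a n" if "n \<ge> t" for T n
    using that
  proof (induction T arbitrary: n)
    case (Suc T)
    have "(\<Sum>i\<le>d. w i * a (n + i)) = w 0 * a n + (\<Sum>i=1..d. w i * a (n + i))"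
      by (simp add: sum.atMost_shift atMost_atLeast0 sum.atLeast_Suc_atMost)
    with w(2)[OF Suc.prems] have w0: "w 0 * a n = - (\<Sum>i=1..d. w i * a (n + i))" by simp
    have "G (Suc T) n = w 0 ^ T * - (\<Sum>i=1..d. w i * a (n + i))"
      using Suc by (simp add: G_Suc sum_distrib_left mult_ac)
    also have "\<dots> = w 0 ^ Suc T * a n"
      by (simp only: w0[symmetric] power_Suc mult_ac)
    finally show ?case .
  qed (simp add: G_0)
  have G_cong: "N dvd G T (n + P) - G T n"
    if "\<forall>n\<ge>t. N dvd a (n + P) - a n" "n + T \<ge> t" for N T n P
    using that(2)
  proof (induction T arbitrary: n)
    case 0
    then show ?case using that(1) by (simp add: G_0)
  next
    case (Suc T)
    have "G (Suc T) (n + P) - G (Suc T) n = - (\<Sum>i=1..d. w i * (G T (n + i + P) - G T (n + i)))"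
      by (simp add: G_Suc right_diff_distrib sum_subtractf add_ac)
    moreover have "N dvd (\<Sum>i=1..d. w i * (G T (n + i + P) - G T (n + i)))"
      using Suc by (intro dvd_sum dvd_mult) auto
    ultimately show ?case by simp
  qed
  \<comment> \<open>With \<open>T = t\<close> the condition \<open>n + T \<ge> t\<close> in
    \<open>G_cong\<close> always holds, so \<open>G t\<close> is periodic modulo \<open>N\<close>
    from index 0 on.\<close>
  have G_mult: "N dvd G t (j * P) - G t 0"
    if "\<forall>n\<ge>t. N dvd a (n + P) - a n" for N P j
  proof (induction j)
    case (Suc j)
    have "N dvd G t (j * P + P) - G t (j * P)" using G_cong[OF that, of "j * P" t] by simp
    from dvd_add[OF this Suc] show ?case by (simp add: add_ac)
  qed simp
  have "p ^ k dvd G t 0" for k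
  proof -
    obtain P where P: "P > 0" "\<forall>n\<ge>t. p ^ k dvd a (n + P) - a n"
      using periodic[of "p ^ k"] p(1) by auto
    obtain Q where Q: "Q > 0" "\<forall>j>0. p ^ k dvd a (j * Q)" using p(2) by blast
    \<comment> \<open>This makes \<open>j * P\<close> a multiple of both \<open>P\<close> and
      \<open>Q\<close> that is at least \<open>t\<close>, where \<open>G_eq\<close> applies.\<close>
    define j where "j = Suc t * Q"
    have "j * P \<ge> t"
    proof -
      have "t \<le> Suc t * 1 * 1" by simp
      also have "\<dots> \<le> Suc t * Q * P" using P(1) Q(1) by (intro mult_le_mono) auto
      finally show ?thesis by (simp add: j_def)
    qed
    then have "G t (j * P) = w 0 ^ t * a (j * P)" by (rule G_eq)
    moreover have "p ^ k dvd a (Suc t * P * Q)" using Q(2) P(1) by (auto simp del: mult_Suc)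
    then have "p ^ k dvd a (j * P)" by (simp only: j_def mult_ac)
    ultimately have "p ^ k dvd G t (j * P)" by simp
    from dvd_diff[OF this G_mult[OF P(2), of j]] show ?thesis by simp
  qed
  then have "G t 0 = 0"
    using p(1) is_unit_iff_infinite_divisor_powers[of "G t 0" p] by auto
  \<comment> \<open>The factor \<open>w 0 ^ t\<close>, by which \<open>G t\<close> is rescaled, is
    cancelled at the end and leaves \<open>s\<close>.\<close>
  define N where "N = \<bar>w 0\<bar> ^ t * s"
  have "N > 0" using w(1) s(1) by (simp add: N_def)
  then obtain P where P: "P > 0" "\<forall>n\<ge>t. N dvd a (n + P) - a n" using periodic by blast
  have "t \<le> Suc t * P" using P(1) by (cases P) auto
  then have "N dvd w 0 ^ t * a (Suc t * P)"
    using G_mult[OF P(2), of "Suc t"] G_eq[of "Suc t * P" t] \<open>G t 0 = 0\<close> by simp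
  then have "w 0 ^ t * s dvd w 0 ^ t * a (Suc t * P)"
    by (simp add: N_def flip: power_abs)
  then have "s dvd a (Suc t * P)" using w(1) by simp
  then show False using s(2) P(1) by simp
qed

subsection \<open>Hankel determinants of analytic continuations\<close>

lemma norm_fps_nth_le:
  assumes "f has_fps_expansion F" "f holomorphic_on ball 0 1" "continuous_on (cball 0 1) f"
    and "\<And>z. norm z = 1 \<Longrightarrow> norm (f z) \<le> B"
  shows "norm (fps_nth F n) \<le> B"
proof -
  have "norm ((deriv ^^ n) f 0) \<le> fact n * B / 1 ^ n"
    by (rule Cauchy_inequality) (use assms in auto)
  then show ?thesis
    by (simp add: fps_nth_fps_expansion[OF assms(1)] norm_divide field_simps)
qed

definition divided_difference :: "(complex \<Rightarrow> complex) \<Rightarrow> complex \<Rightarrow> complex \<Rightarrow> complex" where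
  "divided_difference f y x = (if x = y then deriv f y else (f x - f y) / (x - y))"

lemma holomorphic_divided_difference:
  assumes "f holomorphic_on U" "open U"
  shows "divided_difference f y holomorphic_on U"
proof (cases "y \<in> U")
  case True
  have hol: "(\<lambda>z. f z - f y) holomorphic_on U" by (intro holomorphic_intros assms)
  have "deriv (\<lambda>z. f z - f y) y = deriv f y"
    using assms True by (subst deriv_diff) (auto simp: holomorphic_on_imp_differentiable_at)
  then have "divided_difference f y y = deriv (\<lambda>z. f z - f y) y"
    by (simp add: divided_difference_def)
  then show ?thesis
    by (intro pole_theorem_open_0[OF hol assms(2)]) (simp_all add: divided_difference_def)
next
  case False
  have "(\<lambda>x. (f x - f y) / (x - y)) holomorphic_on U"
    using False by (intro holomorphic_intros assms) auto
  then show ?thesis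
    by (rule holomorphic_transform) (use False in \<open>auto simp: divided_difference_def\<close>)
qed

text \<open>\<open>K\<close> may fail to be convex, so the mean value bound is used only on discs of
  radius \<open>e\<close> inside \<open>U\<close>; for points farther apart the size of
  \<open>f\<close> suffices.\<close>

lemma divided_difference_bounded:
  assumes f: "f holomorphic_on U" "open U" and K: "compact K" "K \<subseteq> U"
  obtains B where "\<And>x y. x \<in> K \<Longrightarrow> y \<in> K \<Longrightarrow> norm (divided_difference f y x) \<le> B"
proof -
  obtain e where e: "e > 0" "(\<Union>x\<in>K. cball x e) \<subseteq> U"
    using compact_subset_open_imp_cball_epsilon_subset[OF K(1) f(2) K(2)] .
  define L where "L = {x + y |x y. x \<in> K \<and> y \<in> cball 0 e}"
  have L: "compact L" unfolding L_def by (intro compact_sums K compact_cball)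
  have cball_L: "cball x e \<subseteq> L" if "x \<in> K" for x
  proof
    fix z assume "z \<in> cball x e"
    then have "z = x + (z - x)" "z - x \<in> cball 0 e" by (auto simp: dist_norm norm_minus_commute)
    then show "z \<in> L" using that unfolding L_def by blast
  qed
  have "L \<subseteq> U"
  proof
    fix z assume "z \<in> L"
    then obtain x y where "z = x + y" "x \<in> K" "y \<in> cball 0 e" by (auto simp: L_def)
    then have "z \<in> cball x e" by (simp add: dist_norm)
    then show "z \<in> U" using e(2) \<open>x \<in> K\<close> by blast
  qed
  have "continuous_on L f" "continuous_on L (deriv f)"
    using f \<open>L \<subseteq> U\<close> holomorphic_deriv[OF f]
    by (auto intro: continuous_on_subset holomorphic_on_imp_continuous_on)
  then have "bounded (f ` L)" "bounded (deriv f ` L)"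
    using L by (auto intro: compact_imp_bounded compact_continuous_image)
  then obtain M M' where M: "\<And>x. x \<in> L \<Longrightarrow> norm (f x) \<le> M"
    and M': "\<And>x. x \<in> L \<Longrightarrow> norm (deriv f x) \<le> M'"
    unfolding bounded_iff by (metis image_eqI)
  have KL: "x \<in> L" if "x \<in> K" for x using cball_L[OF that] e(1) by auto
  show thesis
  proof
    fix x y assume xy: "x \<in> K" "y \<in> K"
    have M0: "M \<ge> 0" "M' \<ge> 0"
      using M[OF KL[OF xy(1)]] M'[OF KL[OF xy(1)]] norm_ge_zero order_trans by blast+
    consider "x = y" | "x \<noteq> y" "norm (x - y) \<le> e" | "norm (x - y) > e" by linarith
    then show "norm (divided_difference f y x) \<le> max M' (2 * M / e)"
    proof cases
      case 1
      then show ?thesis using M'[OF KL[OF xy(1)]] by (auto simp: divided_difference_def)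
    next
      case 2
      have "norm (f x - f y) \<le> M' * norm (x - y)"
      proof (rule field_differentiable_bound[where S = "cball y e" and f' = "deriv f"])
        fix z assume "z \<in> cball y e"
        then have "z \<in> L" using cball_L xy by blast
        then show "norm (deriv f z) \<le> M'" by (rule M')
        show "(f has_field_derivative deriv f z) (at z within cball y e)"
          using \<open>z \<in> L\<close> \<open>L \<subseteq> U\<close>
          by (intro holomorphic_derivI[OF f]) blast
      qed (use 2 e in \<open>auto simp: dist_norm norm_minus_commute\<close>)
      then have "norm (divided_difference f y x) \<le> M'"
        using 2 by (simp add: divided_difference_def norm_divide divide_simps)
      then show ?thesis by simp
    next
      case 3
      have "norm (f x - f y) \<le> M + M"
        using M[OF KL[OF xy(1)]] M[OF KL[OF xy(2)]] norm_triangle_ineq4[of "f x" "f y"] by linarith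
      then have "norm (f x - f y) / norm (x - y) \<le> (M + M) / e"
        using 3 e(1) M0 by (intro frac_le) auto
      moreover have "x \<noteq> y" using 3 e(1) by auto
      ultimately show ?thesis by (simp add: divided_difference_def norm_divide)
    qed
  qed
qed

text \<open>If \<open>C\<close> is the expansion of \<open>g\<close> at 0, this is
  \<open>g y\<close> minus its Taylor terms below \<open>i\<close>, divided by \<open>y ^ i\<close>,
  with the singularity at 0 removed. It continues the series with coefficients
  \<open>fps_nth C (i + j)\<close>.\<close>

fun tail_quotient :: "complex fps \<Rightarrow> (complex \<Rightarrow> complex) \<Rightarrow> nat \<Rightarrow> complex \<Rightarrow> complex" where
  "tail_quotient C g 0 y = g y"
| "tail_quotient C g (Suc i) y =
     (if y = 0 then fps_nth C (Suc i) else (tail_quotient C g i y - fps_nth C i) / y)"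

lemma tail_quotient:
  assumes "g holomorphic_on U" "open U" "0 \<in> U" "g has_fps_expansion C"
  shows "tail_quotient C g i holomorphic_on U \<and> tail_quotient C g i has_fps_expansion fps_shift i C"
proof (induction i)
  case 0
  have "tail_quotient C g 0 = g" by (rule ext) simp
  then show ?case using assms by simp
next
  case (Suc i)
  define h where "h y = tail_quotient C g i y - fps_nth C i" for y
  have h: "h holomorphic_on U" "h has_fps_expansion fps_shift i C - fps_const (fps_nth C i)"
    unfolding h_def using Suc by (auto intro!: holomorphic_intros fps_expansion_intros)
  have h0: "h 0 = 0" using has_fps_expansion_imp_0_eq_fps_nth_0[OF h(2)] by simp
  have "fps_nth C (Suc i) = deriv h 0"
    using fps_nth_fps_expansion[OF h(2), of 1] by simp
  then have hol: "tail_quotient C g (Suc i) holomorphic_on U"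
    using h0 by (intro pole_theorem_open_0[OF h(1) assms(2), of 0]) (auto simp: h_def)
  moreover have "(\<lambda>y. y * tail_quotient C g (Suc i) y) = h"
  proof
    fix y show "y * tail_quotient C g (Suc i) y = h y" using h0 by (auto simp: h_def)
  qed
  moreover have E: "tail_quotient C g (Suc i) has_fps_expansion fps_expansion (tail_quotient C g (Suc i)) 0"
    (is "_ has_fps_expansion ?E") using assms hol by blast
  ultimately have "h has_fps_expansion fps_X * ?E"
    using has_fps_expansion_mult[OF has_fps_expansion_fps_X E] by simp
  then have "fps_X * ?E = fps_shift i C - fps_const (fps_nth C i)"
    using h(2) fps_expansion_unique_complex by blast
  then have "fps_nth (fps_X * ?E) (Suc n) = fps_nth (fps_shift i C - fps_const (fps_nth C i)) (Suc n)"
    for n by simp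
  then have "?E = fps_shift (Suc i) C" by (simp add: fps_eq_iff)
  with hol E show ?case by (simp del: tail_quotient.simps)
qed

text \<open>Comparing coefficients in \<open>(x - y) * D x = x * g x - y * g y\<close> gives the
  recursion of \<open>tail_quotient\<close>. The extra factor \<open>x\<close> makes the double
  series start with \<open>fps_nth C 0\<close>.\<close>

lemma divided_difference_expansion:
  assumes "g holomorphic_on U" "open U" "0 \<in> U" "g has_fps_expansion C" "y \<noteq> 0"
  shows "divided_difference (\<lambda>x. x * g x) y has_fps_expansion Abs_fps (\<lambda>i. tail_quotient C g i y)"
proof -
  define D where "D = divided_difference (\<lambda>x. x * g x) y"
  define E where "E = fps_expansion D 0"
  have "D holomorphic_on U"
    unfolding D_def by (intro holomorphic_divided_difference holomorphic_intros assms)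
  then have DE: "D has_fps_expansion E" using assms unfolding E_def by blast
  then have 1: "(\<lambda>x. (x - y) * D x) has_fps_expansion (fps_X - fps_const y) * E"
    by (intro fps_expansion_intros)
  have "(\<lambda>x. x * g x - y * g y) has_fps_expansion fps_X * C - fps_const (y * g y)"
    using assms by (intro fps_expansion_intros)
  moreover have "(x - y) * D x = x * g x - y * g y" for x
    by (simp add: D_def divided_difference_def)
  ultimately have "(\<lambda>x. (x - y) * D x) has_fps_expansion fps_X * C - fps_const (y * g y)" by simp
  with 1 have eq: "(fps_X - fps_const y) * E = fps_X * C - fps_const (y * g y)"
    using fps_expansion_unique_complex by blast
  have "fps_nth E i = tail_quotient C g i y" for i
  proof (induction i)
    case 0
    have "fps_nth ((fps_X - fps_const y) * E) 0 = fps_nth (fps_X * C - fps_const (y * g y)) 0"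
      by (simp only: eq)
    then show ?case using assms(5) by simp
  next
    case (Suc i)
    have "fps_nth ((fps_X - fps_const y) * E) (Suc i) = fps_nth (fps_X * C - fps_const (y * g y)) (Suc i)"
      by (simp only: eq)
    then have "fps_nth E i - y * fps_nth E (Suc i) = fps_nth C i"
      by (simp add: left_diff_distrib)
    then show ?case using assms(5) Suc by (simp add: field_simps)
  qed
  then have "E = Abs_fps (\<lambda>i. tail_quotient C g i y)" by (simp add: fps_eq_iff)
  then show ?thesis using DE by (simp add: D_def)
qed

text \<open>Substituting \<phi> in both variables replaces the Hankel matrix \<open>A\<close> by
  \<open>T * (A * transpose_mat T)\<close>, whose entries are bounded by a fixed \<open>B\<close>.
  The squared determinant of \<open>T\<close> has modulus \<alpha> to the power
  \<open>n * (n - 1)\<close>, which outweighs \<open>fact n * B ^ n\<close>.\<close>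

lemma hankel_det_eventually_small:
  fixes g \<phi> :: "complex \<Rightarrow> complex"
  assumes g: "g holomorphic_on U" "open U" "0 \<in> U" "g has_fps_expansion C"
    and \<phi>: "\<phi> holomorphic_on V" "open V" "cball 0 1 \<subseteq> V" "\<phi> ` cball 0 1 \<subseteq> U"
      "\<phi> has_fps_expansion \<Phi>" "fps_nth \<Phi> 0 = 0" "norm (fps_nth \<Phi> 1) > 1"
      "\<And>z. norm z = 1 \<Longrightarrow> \<phi> z \<noteq> 0"
  shows "\<forall>\<^sub>F n in sequentially. norm (det (hankel (fps_nth C) 0 n)) < 1"
proof -
  define K where "K = \<phi> ` cball 0 1"
  have "compact K" unfolding K_def
    by (intro compact_continuous_image compact_cball continuous_on_subset[OF _ \<phi>(3)]
        holomorphic_on_imp_continuous_on \<phi>(1))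
  have "(\<lambda>x. x * g x) holomorphic_on U" by (intro holomorphic_intros g)
  then obtain B where B: "\<And>x y. x \<in> K \<Longrightarrow> y \<in> K \<Longrightarrow>
      norm (divided_difference (\<lambda>x. x * g x) y x) \<le> B"
    using divided_difference_bounded[of "\<lambda>x. x * g x" U K] g(2) \<open>compact K\<close> \<phi>(4)
    unfolding K_def by blast
  \<comment> \<open>\<open>k m l\<close> is the coefficient of \<open>u ^ m * v ^ l\<close> in the divided difference of \<open>x * g x\<close> at
    \<open>\<phi> u\<close> and \<open>\<phi> v\<close>; it is extracted first in \<open>u\<close>, giving \<open>\<kappa> m v\<close>, and then in \<open>v\<close>.\<close>
  define k where "k m l = (\<Sum>i\<le>m. \<Sum>j\<le>l. fps_nth (\<Phi> ^ i) m * fps_nth C (i + j) * fps_nth (\<Phi> ^ j) l)" for m l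
  have comp: "(f \<circ> \<phi>) holomorphic_on ball 0 1 \<and> continuous_on (cball 0 1) (f \<circ> \<phi>)"
    if "f holomorphic_on U" for f
  proof
    show "(f \<circ> \<phi>) holomorphic_on ball 0 1"
      by (rule holomorphic_on_compose_gen[OF _ that]) (use \<phi> in \<open>force intro: holomorphic_on_subset\<close>)+
    show "continuous_on (cball 0 1) (f \<circ> \<phi>)"
      using \<phi> that by (intro continuous_on_compose)
        (auto intro: continuous_on_subset holomorphic_on_imp_continuous_on)
  qed
  define \<kappa> where "\<kappa> m v = (\<Sum>i\<le>m. fps_nth (\<Phi> ^ i) m * (tail_quotient C g i \<circ> \<phi>) v)" for m v
  have \<kappa>_bound: "norm (\<kappa> m v) \<le> B" if "norm v = 1" for m v
  proof -
    have y: "\<phi> v \<noteq> 0" "\<phi> v \<in> K" using \<phi>(8) that by (auto simp: K_def)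
    define D where "D = divided_difference (\<lambda>x. x * g x) (\<phi> v)"
    have "D holomorphic_on U"
      unfolding D_def by (intro holomorphic_divided_difference holomorphic_intros g)
    note comp[OF this]
    moreover have "(D \<circ> \<phi>) has_fps_expansion (Abs_fps (\<lambda>i. tail_quotient C g i (\<phi> v)) oo \<Phi>)"
      unfolding D_def by (intro has_fps_expansion_compose divided_difference_expansion[OF g] \<phi> y)
    moreover have "norm ((D \<circ> \<phi>) z) \<le> B" if "norm z = 1" for z
      using that y(2) by (auto simp: D_def K_def intro!: B)
    ultimately have "norm (fps_nth (Abs_fps (\<lambda>i. tail_quotient C g i (\<phi> v)) oo \<Phi>) m) \<le> B"
      by (intro norm_fps_nth_le) auto
    then show ?thesis by (simp add: \<kappa>_def fps_compose_nth mult.commute atLeast0AtMost)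
  qed
  \<comment> \<open>Cauchy's estimate again, now in \<open>v\<close>: the bound for
    \<open>\<kappa> m\<close> on the circle passes to its coefficients.\<close>
  have k_bound: "norm (k m l) \<le> B" for m l
  proof -
    have "\<kappa> m holomorphic_on ball 0 1" "continuous_on (cball 0 1) (\<kappa> m)"
      unfolding \<kappa>_def using comp tail_quotient[OF g]
      by (intro holomorphic_on_sum holomorphic_on_mult holomorphic_on_const
          continuous_on_sum continuous_on_mult continuous_on_const; blast)+
    moreover have "\<kappa> m has_fps_expansion (\<Sum>i\<le>m. fps_const (fps_nth (\<Phi> ^ i) m) * (fps_shift i C oo \<Phi>))"
      unfolding \<kappa>_def using tail_quotient[OF g] \<phi>
      by (intro has_fps_expansion_sum has_fps_expansion_cmult_left has_fps_expansion_compose) auto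
    ultimately have "norm (fps_nth (\<Sum>i\<le>m. fps_const (fps_nth (\<Phi> ^ i) m) * (fps_shift i C oo \<Phi>)) l) \<le> B"
      using \<kappa>_bound by (intro norm_fps_nth_le)
    then show ?thesis
      by (simp add: k_def fps_sum_nth fps_compose_nth sum_distrib_left mult.assoc atLeast0AtMost add.commute)
  qed
  define \<alpha> where "\<alpha> = norm (fps_nth \<Phi> 1)"
  have "\<alpha> > 1" using \<phi>(7) by (simp add: \<alpha>_def)
  have bound: "norm (det (hankel (fps_nth C) 0 n)) * (\<alpha> ^ (n - 1)) ^ n \<le> fact n * B ^ n" for n
  proof -
    \<comment> \<open>Column \<open>i\<close> holds the coefficients of \<open>\<Phi> ^ i\<close>;
      as \<Phi> has no constant term, \<open>T\<close> is lower triangular.\<close>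
    define T where "T = mat n n (\<lambda>(m, i). fps_nth (\<Phi> ^ i) m)"
    define A where "A = hankel (fps_nth C) 0 n"
    have T: "T \<in> carrier_mat n n" and A: "A \<in> carrier_mat n n" by (simp_all add: T_def A_def)
    have "det T = (\<Prod>i<n. fps_nth \<Phi> 1 ^ i)"
    proof -
      have "det T = prod_list (diag_mat T)"
        using startsby_zero_power_prefix[OF \<phi>(6)] T
        by (intro det_lower_triangular[of n T]) (auto simp: T_def)
      also have "\<dots> = (\<Prod>i<n. fps_nth \<Phi> 1 ^ i)"
        using startsby_zero_power_nth_same[OF \<phi>(6)] T
        by (simp add: prod_list_diag_prod T_def lessThan_atLeast0)
      finally show ?thesis .
    qed
    then have "norm (det T) = (\<Prod>i<n. \<alpha> ^ i)"
      by (simp add: \<alpha>_def norm_power prod_norm[symmetric])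
    then have "norm (det T) ^ 2 = (\<alpha> ^ (\<Sum>i<n. i)) ^ 2"
      by (simp add: power_sum)
    also have "\<dots> = (\<alpha> ^ (n - 1)) ^ n"
    proof -
      have "(\<Sum>i<n. i) * 2 = (n - 1) * n"
      proof (induction n)
        case (Suc n)
        then show ?case by (cases n) (auto simp: algebra_simps)
      qed simp
      then show ?thesis by (simp flip: power_mult)
    qed
    finally have detT: "norm (det T) ^ 2 = (\<alpha> ^ (n - 1)) ^ n" .
    have "norm (det (T * (A * transpose_mat T))) \<le> fact n * B ^ n"
    proof (rule norm_det_le)
      fix m l assume ml: "m < n" "l < n"
      have AT: "(A * transpose_mat T) $$ (i, l) = (\<Sum>j\<le>l. fps_nth C (i + j) * fps_nth (\<Phi> ^ j) l)"
        if "i < n" for i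
      proof -
        have "(A * transpose_mat T) $$ (i, l) = (\<Sum>j<n. fps_nth C (i + j) * fps_nth (\<Phi> ^ j) l)"
          using ml that T A by (simp add: A_def T_def hankel_def scalar_prod_def lessThan_atLeast0)
        also have "\<dots> = (\<Sum>j\<le>l. fps_nth C (i + j) * fps_nth (\<Phi> ^ j) l)"
          using ml startsby_zero_power_prefix[OF \<phi>(6)] by (intro sum.mono_neutral_right) auto
        finally show ?thesis .
      qed
      have "(T * (A * transpose_mat T)) $$ (m, l) =
          (\<Sum>i<n. fps_nth (\<Phi> ^ i) m * (A * transpose_mat T) $$ (i, l))"
        using ml T A by (simp add: T_def scalar_prod_def lessThan_atLeast0)
      also have "\<dots> = (\<Sum>i\<le>m. fps_nth (\<Phi> ^ i) m * (A * transpose_mat T) $$ (i, l))"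
        using ml startsby_zero_power_prefix[OF \<phi>(6)] by (intro sum.mono_neutral_right) auto
      also have "\<dots> = k m l"
        unfolding k_def using ml by (intro sum.cong) (auto simp: AT sum_distrib_left mult.assoc)
      finally show "norm ((T * (A * transpose_mat T)) $$ (m, l)) \<le> B" using k_bound by simp
    qed (use T A in auto)
    also have "det (T * (A * transpose_mat T)) = det T * (det A * det T)"
      using T A by (simp add: det_mult[of _ n] det_transpose)
    finally show ?thesis
      unfolding detT[symmetric] by (simp add: A_def norm_mult power2_eq_square mult_ac)
  qed
  have "norm (k 0 0) \<le> B" by (rule k_bound)
  then have "B \<ge> 0" using norm_ge_zero order_trans by blast
  \<comment> \<open>This gives \<open>n * B < \<alpha> ^ (n - 1)\<close> for large \<open>n\<close>;
    its \<open>n\<close>-th power suffices, since \<open>fact n \<le> n ^ n\<close>.\<close>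
  have "(\<lambda>n. B * \<alpha> * (real n / \<alpha> ^ n)) \<longlonglongrightarrow> B * \<alpha> * 0"
    using \<open>\<alpha> > 1\<close> by (intro tendsto_intros lim_n_over_pown) auto
  then have "\<forall>\<^sub>F n in sequentially. B * \<alpha> * (real n / \<alpha> ^ n) < 1"
    by (rule order_tendstoD) simp
  then show ?thesis
    using eventually_gt_at_top[of 0]
  proof eventually_elim
    case (elim n)
    define x where "x = \<alpha> ^ (n - 1)"
    have "x > 0" using \<open>\<alpha> > 1\<close> by (simp add: x_def)
    have "\<alpha> ^ n = \<alpha> * x" using elim by (cases n) (auto simp: x_def)
    then have *: "real n * B < x" using elim \<open>x > 0\<close> \<open>\<alpha> > 1\<close> by (simp add: divide_simps mult_ac)
    have "norm (det (hankel (fps_nth C) 0 n)) * x ^ n \<le> fact n * B ^ n"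
      using bound[of n] by (simp add: x_def)
    also have "\<dots> \<le> real (n ^ n) * B ^ n"
      using \<open>B \<ge> 0\<close> fact_le_power[of n] by (intro mult_right_mono) (auto simp flip: of_nat_power)
    also have "\<dots> = (real n * B) ^ n" by (simp add: power_mult_distrib)
    also have "\<dots> < x ^ n" using * \<open>B \<ge> 0\<close> elim by (intro power_strict_mono) auto
    finally show ?case using \<open>x > 0\<close> by simp
  qed
qed

section \<open>A map of the closed disc that bulges through one boundary point\<close>

lemma Re_Cayley: "s \<noteq> 1 \<Longrightarrow> Re ((1 + s) / (1 - s)) = (1 - (norm s)\<^sup>2) / (norm (1 - s))\<^sup>2"
  by (simp add: Re_divide cmod_power2) (simp add: power2_eq_square algebra_simps)

text \<open>\<phi> is the rotation by \<zeta> multiplied by \<open>1 + \<delta> * P u\<close>. It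
  pushes outward only near \<zeta>, where \<open>U\<close> has room, and pulls the rest of the
  circle inside, yet its derivative at 0 has modulus \<open>1 + \<delta> / 2\<close>.\<close>

lemma exists_expanding_disc_map:
  assumes "open U" "ball 0 1 \<subseteq> U" "\<zeta> \<in> U" "norm \<zeta> = 1"
  obtains \<phi> V where "\<phi> holomorphic_on V" "open V" "cball 0 1 \<subseteq> V" "\<phi> ` cball 0 1 \<subseteq> U"
    "\<phi> 0 = 0" "norm (deriv \<phi> 0) > 1" "\<And>z. norm z = 1 \<Longrightarrow> \<phi> z \<noteq> 0"
proof -
  obtain e0 where "e0 > 0" "ball \<zeta> e0 \<subseteq> U" using assms by (meson openE)
  define e where "e = min e0 1"
  have e: "0 < e" "e \<le> 1" "ball \<zeta> e \<subseteq> U" using \<open>e0 > 0\<close> \<open>ball \<zeta> e0 \<subseteq> U\<close> by (auto simp: e_def)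
  \<comment> \<open>Chosen so that \<open>2 * \<eta> * K = 1 / 4\<close>: on the circle away from 1
    the Poisson kernel is then at most 1/4.\<close>
  define \<eta> where "\<eta> = e\<^sup>2 / 128"
  have "e\<^sup>2 \<le> e" using e power_le_one[of e 1] by (simp add: power2_eq_square mult_left_le)
  then have \<eta>: "0 < \<eta>" "\<eta> \<le> e / 128" using e by (auto simp: \<eta>_def)
  define \<sigma> where "\<sigma> = 1 - \<eta>"
  have \<sigma>: "0 < \<sigma>" "\<sigma> < 1" using \<eta> e by (auto simp: \<sigma>_def)
  \<comment> \<open>\<open>M\<close> bounds \<open>P\<close> on the closed disc; \<open>K\<close>
    bounds the inverse square of the denominator of \<open>P\<close> at distance at least
    \<open>e / 2\<close> from 1.\<close>
  define M where "M = 3 / \<eta>"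
  define K where "K = 16 / e\<^sup>2"
  have MK: "M > 0" "K > 0" using \<eta> e by (auto simp: M_def K_def)
  \<comment> \<open>The constraints make the quadratic term at most \<open>\<delta> / 4\<close>,
    keep \<phi> near \<zeta> when \<open>u\<close> is near 1, and limit the interior gain to
    \<open>(1 - x) / 2\<close>.\<close>
  define \<delta> where "\<delta> = min (1 / (4 * M\<^sup>2)) (min (e / (4 * M)) (1 / (4 * K)))"
  have \<delta>: "\<delta> > 0" "\<delta> * M\<^sup>2 \<le> 1 / 4" "\<delta> * M \<le> e / 4" "2 * \<delta> * K \<le> 1 / 2"
  proof -
    show "\<delta> > 0" using MK e by (simp add: \<delta>_def)
    have "\<delta> \<le> 1 / (4 * M\<^sup>2)" "\<delta> \<le> e / (4 * M)" "\<delta> \<le> 1 / (4 * K)" by (simp_all add: \<delta>_def)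
    then show "\<delta> * M\<^sup>2 \<le> 1 / 4" "\<delta> * M \<le> e / 4" "2 * \<delta> * K \<le> 1 / 2"
      using MK by (simp_all add: field_simps)
  qed
  \<comment> \<open>Up to the shift by \<open>1/2\<close>, the real part of \<open>P\<close> is the Poisson kernel: on the unit circle it is
    negative away from \<open>1\<close>, although \<open>P 0 = 1/2 > 0\<close>.\<close>
  define P where "P u = (1 + of_real \<sigma> * u) / (1 - of_real \<sigma> * u) - 1 / 2" for u :: complex
  define \<phi> where "\<phi> u = u * (\<zeta> * (1 + of_real \<delta> * P u))" for u
  define V where "V = ball (0::complex) (1 / \<sigma>)"
  have V: "1 - of_real \<sigma> * u \<noteq> 0" if "u \<in> V" for u
  proof
    assume "1 - of_real \<sigma> * u = 0"
    then have "norm (of_real \<sigma> * u) = norm (1::complex)" by simp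
    then show False using that \<sigma> by (simp add: V_def norm_mult field_simps)
  qed
  have "1 / \<sigma> > 1" using \<sigma> by simp
  then have "cball 0 1 \<subseteq> V" unfolding V_def by auto
  have lower: "norm (1 - of_real \<sigma> * u) \<ge> \<eta>" and P_le: "norm (P u) \<le> M" if "norm u \<le> 1" for u
  proof -
    have su: "norm (of_real \<sigma> * u) \<le> \<sigma>" using that \<sigma> by (simp add: norm_mult mult_left_le)
    then show *: "norm (1 - of_real \<sigma> * u) \<ge> \<eta>"
      using norm_triangle_ineq2[of 1 "of_real \<sigma> * u"] by (simp add: \<sigma>_def)
    have "norm (1 + of_real \<sigma> * u) \<le> 2"
      using norm_triangle_ineq[of 1 "of_real \<sigma> * u"] su \<sigma> by simp
    then have "norm ((1 + of_real \<sigma> * u) / (1 - of_real \<sigma> * u)) \<le> 2 / \<eta>"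
      unfolding norm_divide using * \<eta> by (intro frac_le) auto
    moreover have "norm (P u) \<le> norm ((1 + of_real \<sigma> * u) / (1 - of_real \<sigma> * u)) + norm (1 / 2 :: complex)"
      unfolding P_def by (rule norm_triangle_ineq4)
    moreover have "1 / 2 \<le> 1 / \<eta>" using \<eta> e by (intro divide_left_mono) auto
    ultimately show "norm (P u) \<le> M" by (simp add: M_def)
  qed
  have dP: "norm (of_real \<delta> * P u) \<le> e / 4" if "norm u \<le> 1" for u
  proof -
    have "norm (of_real \<delta> * P u) \<le> \<delta> * M"
      using P_le[OF that] \<delta>(1) by (simp add: norm_mult)
    then show ?thesis using \<delta>(3) by linarith
  qed
  \<comment> \<open>Near 1 the image stays in the disc around \<zeta>; elsewhere it stays in the
    open unit disc.\<close>
  have in_U: "\<phi> u \<in> U" if u: "norm u \<le> 1" for u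
  proof (cases "norm (u - 1) < e / 2")
    case True
    have "\<phi> u - \<zeta> = \<zeta> * ((u - 1) + u * (of_real \<delta> * P u))"
      by (simp add: \<phi>_def algebra_simps)
    also have "norm \<dots> \<le> norm (u - 1) + norm u * norm (of_real \<delta> * P u)"
      using assms(4) norm_triangle_ineq[of "u - 1" "u * (of_real \<delta> * P u)"] by (simp add: norm_mult)
    also have "\<dots> \<le> norm (u - 1) + 1 * (e / 4)"
      using dP[OF u] u by (intro add_left_mono mult_mono) auto
    also have "\<dots> < e" using True e by simp
    finally have "\<phi> u \<in> ball \<zeta> e" by (simp add: dist_norm norm_minus_commute)
    then show ?thesis using e(3) by blast
  next
    case False
    define x where "x = (norm u)\<^sup>2"
    have x: "0 \<le> x" "x \<le> 1" using u by (auto simp: x_def power_le_one)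
    have ne: "of_real \<sigma> * u \<noteq> 1" using lower[OF u] \<eta> by auto
    have "norm (u - of_real \<sigma> * u) = \<eta> * norm u"
    proof -
      have "u - of_real \<sigma> * u = of_real \<eta> * u" by (simp add: \<sigma>_def algebra_simps)
      then show ?thesis using \<eta> by (simp add: norm_mult)
    qed
    also have "\<dots> \<le> \<eta>" using \<eta> u by (intro mult_left_le) auto
    also have "\<dots> \<le> e / 4" using \<eta> e by simp
    finally have "norm (1 - of_real \<sigma> * u) \<ge> e / 4"
      using False norm_triangle_ineq4[of "u - of_real \<sigma> * u" "1 - of_real \<sigma> * u"] by simp
    then have "(norm (1 - of_real \<sigma> * u))\<^sup>2 \<ge> (e / 4)\<^sup>2" using e by (intro power_mono) auto
    moreover have "\<sigma>\<^sup>2 * x \<le> 1" using x \<sigma> by (simp add: mult_le_one power_le_one)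
    ultimately have "(1 - \<sigma>\<^sup>2 * x) / (norm (1 - of_real \<sigma> * u))\<^sup>2 \<le> (1 - \<sigma>\<^sup>2 * x) / (e / 4)\<^sup>2"
      using e by (intro divide_left_mono) (auto intro!: mult_pos_pos zero_less_power ne[symmetric] simp: ne[symmetric])
    also have "\<dots> = K * (1 - \<sigma>\<^sup>2 * x)" by (simp add: K_def power_divide)
    also have "\<dots> \<le> K * ((1 - x) + 2 * \<eta>)"
    proof -
      have "1 - \<sigma>\<^sup>2 * x = (1 - x) + x * (\<eta> * (1 + \<sigma>))"
        by (simp add: \<sigma>_def power2_eq_square algebra_simps)
      also have "x * (\<eta> * (1 + \<sigma>)) \<le> 1 * (\<eta> * 2)" using x \<sigma> \<eta> by (intro mult_mono) auto
      finally show ?thesis using MK by simp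
    qed
    also have "\<dots> = K * (1 - x) + 1 / 4" using e by (simp add: K_def \<eta>_def field_simps)
    finally have "Re (P u) \<le> K * (1 - x) - 1 / 4"
      using Re_Cayley[OF ne] \<sigma> by (simp add: P_def norm_mult power_mult_distrib x_def)
    then have "2 * \<delta> * Re (P u) \<le> 2 * \<delta> * (K * (1 - x) - 1 / 4)"
      using \<delta>(1) by (intro mult_left_mono) auto
    moreover have "(2 * \<delta> * K) * (1 - x) \<le> 1 / 2 * (1 - x)"
      using \<delta>(4) x by (intro mult_right_mono) auto
    moreover have "\<delta>\<^sup>2 * (norm (P u))\<^sup>2 \<le> \<delta> / 4"
    proof -
      have "\<delta>\<^sup>2 * (norm (P u))\<^sup>2 \<le> \<delta>\<^sup>2 * M\<^sup>2"
        using P_le[OF u] by (intro mult_left_mono power_mono) auto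
      also have "\<dots> = \<delta> * (\<delta> * M\<^sup>2)" by (simp add: power2_eq_square)
      also have "\<dots> \<le> \<delta> * (1 / 4)" using \<delta> by (intro mult_left_mono) auto
      finally show ?thesis by simp
    qed
    moreover have "(norm (1 + of_real \<delta> * P u))\<^sup>2 = 1 + 2 * \<delta> * Re (P u) + \<delta>\<^sup>2 * (norm (P u))\<^sup>2"
      unfolding cmod_power2 by (simp add: power2_eq_square algebra_simps)
    \<comment> \<open>The first-order loss \<open>\<delta> / 2\<close> exceeds the quadratic error
      \<open>\<delta> / 4\<close>.\<close>
    ultimately have bound: "(norm (1 + of_real \<delta> * P u))\<^sup>2 \<le> 1 + (1 - x) / 2 - \<delta> / 4"
      by (simp add: algebra_simps)
    have "(norm (\<phi> u))\<^sup>2 = x * (norm (1 + of_real \<delta> * P u))\<^sup>2"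
      using assms(4) by (simp add: \<phi>_def norm_mult power_mult_distrib x_def)
    also have "\<dots> \<le> x * (1 + (1 - x) / 2 - \<delta> / 4)"
      using bound x by (intro mult_left_mono)
    also have "\<dots> < 1"
    proof (cases "x = 1")
      case False
      have "x * (1 + (1 - x) / 2 - \<delta> / 4) \<le> x * (1 + (1 - x) / 2)"
        using x(1) \<delta>(1) by (intro mult_left_mono) linarith+
      also have "\<dots> = x + x * ((1 - x) / 2)" by (simp add: algebra_simps)
      also have "\<dots> \<le> x + 1 * ((1 - x) / 2)" using x by (intro add_left_mono mult_right_mono) auto
      also have "\<dots> < 1" using x False by (simp add: field_simps)
      finally show ?thesis .
    qed (use \<delta> in auto)
    finally have "norm (\<phi> u) < 1" by (simp add: power2_less_1_iff)
    then show ?thesis using assms(2) by auto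
  qed
  have P_hol: "P holomorphic_on V" unfolding P_def using V by (intro holomorphic_intros) auto
  show thesis
  proof
    show "\<phi> holomorphic_on V" unfolding \<phi>_def by (intro holomorphic_intros P_hol)
    show "open V" by (simp add: V_def)
    show "cball 0 1 \<subseteq> V" by fact
    show "\<phi> ` cball 0 1 \<subseteq> U" using in_U by auto
    show "\<phi> 0 = 0" by (simp add: \<phi>_def)
    have "P field_differentiable at 0"
      using P_hol \<open>cball 0 1 \<subseteq> V\<close> by (intro holomorphic_on_imp_differentiable_at[of _ V]) (use \<sigma>(1) in \<open>auto simp: V_def\<close>)
    then obtain P' where "(P has_field_derivative P') (at 0)" by (auto simp: field_differentiable_def)
    then have "(\<phi> has_field_derivative \<zeta> * (1 + of_real \<delta> * P 0)) (at 0)"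
      unfolding \<phi>_def by (auto intro!: derivative_eq_intros)
    then have "deriv \<phi> 0 = \<zeta> * of_real (1 + \<delta> / 2)"
      by (simp add: DERIV_imp_deriv P_def)
    then have "norm (deriv \<phi> 0) = \<bar>1 + \<delta> / 2\<bar>"
      by (simp only: norm_mult norm_of_real assms(4) mult_1)
    then show "norm (deriv \<phi> 0) > 1" using \<delta>(1) by (simp add: abs_of_pos)
    show "\<phi> z \<noteq> 0" if "norm z = 1" for z
    proof
      assume "\<phi> z = 0"
      moreover have "z \<noteq> 0" "\<zeta> \<noteq> 0" using that assms(4) by auto
      ultimately have "of_real \<delta> * P z = -1" by (simp add: \<phi>_def add_eq_0_iff)
      then show False using dP[of z] that e by simp
    qed
  qed
qed

text \<open>Connectedness gives \<open>U\<close> a point of the unit circle, as the disc map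
  requires. Integrality turns determinants of modulus below 1 into zeros.\<close>

lemma integer_series_continuation_imp_hankel_0:
  fixes a :: "nat \<Rightarrow> int"
  assumes U: "open U" "connected U" "ball 0 1 \<subset> U" and g: "g holomorphic_on U"
    and F: "fps_conv_radius F > 0" "\<And>n. fps_nth F n = of_int (a n)"
      "\<And>z. z \<in> ball 0 1 \<Longrightarrow> g z = eval_fps F z"
  obtains n0 where "\<And>n. n \<ge> n0 \<Longrightarrow> det (hankel a 0 n) = 0"
proof -
  have "(0::complex) \<in> ball 0 1" by simp
  then have "0 \<in> U" "U \<inter> ball 0 1 \<noteq> {}" "U - ball 0 1 \<noteq> {}" using U(3) by blast+
  then have "U \<inter> frontier (ball 0 1) \<noteq> {}" using U(2) connected_Int_frontier by blast
  then obtain \<zeta> where \<zeta>: "\<zeta> \<in> U" "norm \<zeta> = 1" by auto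
  obtain \<phi> V where \<phi>: "\<phi> holomorphic_on V" "open V" "cball 0 1 \<subseteq> V" "\<phi> ` cball 0 1 \<subseteq> U"
    "\<phi> 0 = 0" "norm (deriv \<phi> 0) > 1" "\<And>z. norm z = 1 \<Longrightarrow> \<phi> z \<noteq> 0"
    using exists_expanding_disc_map[OF U(1) _ \<zeta>] U(3) by blast
  have "0 \<in> V" using \<phi>(3) by auto
  then have \<Phi>: "\<phi> has_fps_expansion fps_expansion \<phi> 0" using \<phi> by blast
  have "\<forall>\<^sub>F z in nhds (0::complex). z \<in> ball 0 1" by (intro eventually_nhds_in_open) auto
  then have "\<forall>\<^sub>F z in nhds 0. eval_fps F z = g z"
    by eventually_elim (simp add: F(3))
  then have gF: "g has_fps_expansion F" using F(1) by (simp add: has_fps_expansion_def)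
  have "\<forall>\<^sub>F n in sequentially. norm (det (hankel (fps_nth F) 0 n)) < 1"
    using \<open>0 \<in> U\<close> \<phi>(5,6)
    by (intro hankel_det_eventually_small[OF g U(1) _ gF \<phi>(1-4) \<Phi> _ _ \<phi>(7)])
       (auto simp: fps_expansion_def)
  moreover have "fps_nth F = (\<lambda>n. of_int (a n))" using F(2) by blast
  ultimately have "\<forall>\<^sub>F n in sequentially. det (hankel a 0 n) = 0"
    by (simp add: det_hankel_of_int flip: of_int_abs)
  then show thesis using that by (auto simp: eventually_sequentially)
qed

lemma fps_conv_radius_coeff_bound:
  fixes F :: "complex fps"
  assumes "fps_conv_radius F = 1" "x > 1"
  shows "\<exists>C. \<forall>n. norm (fps_nth F n) \<le> C * x ^ n"
proof -
  have "summable (\<lambda>n. fps_nth F n * of_real (1 / x) ^ n)"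
    using assms by (intro summable_fps) (simp add: norm_divide)
  then have "Bseq (\<lambda>n. fps_nth F n * of_real (1 / x) ^ n)"
    by (intro convergent_imp_Bseq) (auto dest: summable_LIMSEQ_zero simp: convergent_def)
  then obtain C where "\<And>n. norm (fps_nth F n * of_real (1 / x) ^ n) \<le> C"
    by (meson BseqE)
  then have "norm (fps_nth F n) \<le> C * x ^ n" for n
    using assms(2) by (simp add: norm_mult norm_power norm_divide power_divide field_simps)
  then show ?thesis by blast
qed

subsection \<open>Product formula and the coefficients of the series\<close>

lemma multiplicity_int_eq: "multiplicity (int p) x = multiplicity p (nat \<bar>x\<bar>)"
proof -
  have "int p ^ n dvd x \<longleftrightarrow> p ^ n dvd nat \<bar>x\<bar>" for n
    using dvd_nat_abs_iff[of "p ^ n" x] by simp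
  then show ?thesis by (simp add: multiplicity_def)
qed

text \<open>For \<open>n > 0\<close>, the largest divisor of \<open>n\<close> without prime factors
  in \<open>S\<close>.\<close>

definition coprime_part :: "nat set \<Rightarrow> nat \<Rightarrow> nat" where
  "coprime_part S n = (\<Prod>p \<in> prime_factors n - S. p ^ multiplicity p n)"

text \<open>All primes of the denominator lie in \<open>S\<close>, so their contribution to
  \<open>S_abs\<close> cancels the denominator; the numerator loses exactly its
  \<open>S\<close>-part.\<close>

lemma abs_mult_S_abs:
  assumes S: "\<And>p. p \<in> S \<Longrightarrow> prime p" and q: "quotient_of x = (u, w)" and "x \<noteq> 0"
    and w: "\<And>p. prime p \<Longrightarrow> int p dvd w \<Longrightarrow> p \<in> S"
  shows "\<bar>real_of_rat x\<bar> * S_abs S x = real (coprime_part S (nat \<bar>u\<bar>))"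
proof -
  define c d where "c = nat \<bar>u\<bar>" and "d = nat \<bar>w\<bar>"
  have "w > 0" using quotient_of_denom_pos[OF q] .
  have x: "x = of_int u / of_int w" using quotient_of_div[OF q] .
  have "c > 0" "d > 0" using x \<open>x \<noteq> 0\<close> \<open>w > 0\<close> by (auto simp: c_def d_def)
  have padic: "padic_abs p x = real p ^ multiplicity p d / real p ^ multiplicity p c" if "prime p" for p
    using prime_gt_0_nat[OF that] \<open>x \<noteq> 0\<close>
    by (simp add: padic_abs_def q multiplicity_int_eq c_def d_def power_int_diff)
  define A where "A = S \<inter> (prime_factors c \<union> prime_factors d)"
  have A: "finite A" "A \<subseteq> S" by (auto simp: A_def)
  have "S_abs S x = (\<Prod>p \<in> {p \<in> S. padic_abs p x \<noteq> 1}. padic_abs p x)"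
    using \<open>x \<noteq> 0\<close> by (simp add: S_abs_def)
  also have "\<dots> = (\<Prod>p\<in>A. padic_abs p x)"
  proof (intro prod.mono_neutral_left A(1) ballI)
    show "{p \<in> S. padic_abs p x \<noteq> 1} \<subseteq> A"
    proof
      fix p assume p: "p \<in> {p \<in> S. padic_abs p x \<noteq> 1}"
      then have "multiplicity p c \<noteq> 0 \<or> multiplicity p d \<noteq> 0"
        using padic[OF S] by (metis (mono_tags, lifting) div_by_1 mem_Collect_eq power_0)
      then show "p \<in> A" using p S by (auto simp: A_def prime_factors_multiplicity)
    qed
  qed (use A(2) in auto)
  also have "\<dots> = (\<Prod>p\<in>A. real p ^ multiplicity p d) / (\<Prod>p\<in>A. real p ^ multiplicity p c)"
    using A(2) S by (simp add: padic subset_iff flip: prod_dividef)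
  also have "(\<Prod>p\<in>A. real p ^ multiplicity p d) = (\<Prod>p\<in>prime_factors d. real p ^ multiplicity p d)"
  proof (intro prod.mono_neutral_right A(1) ballI)
    show "prime_factors d \<subseteq> A"
    proof
      fix p assume p: "p \<in> prime_factors d"
      then have "int p dvd w" by (auto simp: d_def in_prime_factors_iff)
      with p w show "p \<in> A" by (auto simp: A_def in_prime_factors_iff)
    qed
    show "real p ^ multiplicity p d = 1" if "p \<in> A - prime_factors d" for p
      using that S by (auto simp: A_def prime_factors_multiplicity)
  qed
  also have "\<dots> = real d"
    using \<open>d > 0\<close> prod_prime_factors[of d] by (simp flip: of_nat_power of_nat_prod)
  also have "(\<Prod>p\<in>A. real p ^ multiplicity p c) = (\<Prod>p\<in>S \<inter> prime_factors c. real p ^ multiplicity p c)"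
    using S by (intro prod.mono_neutral_right A(1) ballI) (auto simp: A_def prime_factors_multiplicity)
  finally have S_eq: "S_abs S x = real d / (\<Prod>p\<in>S \<inter> prime_factors c. real p ^ multiplicity p c)" (is "_ = _ / ?D") .
  have "real c = (\<Prod>p\<in>prime_factors c. real p ^ multiplicity p c)"
    using \<open>c > 0\<close> prod_prime_factors[of c] by (simp flip: of_nat_power of_nat_prod)
  also have "prime_factors c = (prime_factors c - S) \<union> (S \<inter> prime_factors c)" by auto
  also have "(\<Prod>p\<in>\<dots>. real p ^ multiplicity p c) = real (coprime_part S c) * ?D"
    by (subst prod.union_disjoint) (auto simp: coprime_part_def)
  finally have c_eq: "real c = real (coprime_part S c) * ?D" .
  then have "?D \<noteq> 0" using \<open>c > 0\<close> by auto
  have "\<bar>real_of_rat x\<bar> = real c / real d"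
    using \<open>w > 0\<close> by (simp add: x of_rat_divide c_def d_def)
  then show ?thesis
    using \<open>d > 0\<close> \<open>?D \<noteq> 0\<close> by (simp add: S_eq c_eq flip: c_def)
qed

section \<open>Divisibility properties of the coefficients\<close>

lemma not_dvd_coprime_part:
  assumes "prime s" "s \<in> S"
  shows "\<not> s dvd coprime_part S n"
proof
  assume "s dvd coprime_part S n"
  then obtain p where p: "p \<in> prime_factors n - S" "s dvd p ^ multiplicity p n"
    unfolding coprime_part_def using assms by (subst (asm) prime_dvd_prod_iff) auto
  then have "s = p" using assms(1)
    by (meson DiffD1 in_prime_factors_imp_prime prime_dvd_power primes_dvd_imp_eq)
  with p assms show False by simp
qed

lemma prime_power_dvd_coprime_part:
  assumes "prime p" "p \<notin> S" "p ^ k dvd n" "n > 0"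
  shows "p ^ k dvd coprime_part S n"
proof (cases "k = 0")
  case False
  then have "p dvd n" using assms(3) dvd_power[of k p] by (meson dvd_trans neq0_conv)
  then have "p ^ multiplicity p n dvd coprime_part S n"
    unfolding coprime_part_def using assms by (intro dvd_prodI) (auto simp: in_prime_factors_iff)
  moreover have "k \<le> multiplicity p n"
    using assms by (intro multiplicity_geI) auto
  ultimately show ?thesis using le_imp_power_dvd dvd_trans by blast
qed simp

lemma quotient_of_power_minus_1:
  assumes "quotient_of r = (u, w)"
  shows "quotient_of (r ^ n - 1) = (u ^ n - w ^ n, w ^ n)"
proof -
  have w: "w > 0" and cop: "coprime u w"
    using quotient_of_denom_pos[OF assms] quotient_of_coprime[OF assms] by auto
  have "r ^ n - 1 = of_int (u ^ n - w ^ n) / of_int (w ^ n)"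
    using w by (simp add: quotient_of_div[OF assms] power_divide diff_divide_distrib)
  also have "\<dots> = Rat.Fract (u ^ n - w ^ n) (w ^ n)" by (simp add: Rat.Fract_of_int_quotient)
  finally have "r ^ n - 1 = Rat.Fract (u ^ n - w ^ n) (w ^ n)" .
  moreover have "coprime (u ^ n - w ^ n) (w ^ n)"
  proof -
    have "gcd (u ^ n - w ^ n) (w ^ n) = gcd (u ^ n) (w ^ n)"
      by (metis gcd_diff1)
    then show ?thesis using cop by (simp add: coprime_iff_gcd_eq_1)
  qed
  ultimately show ?thesis using w by (simp add: quotient_of_Fract Rat.normalize_def coprime_iff_gcd_eq_1)
qed

text \<open>Euler's theorem for a possibly negative base, via its residue as a natural
  number.\<close>

lemma coprime_imp_ex_power_cong_1:
  fixes u :: int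
  assumes "coprime u m" "m > 0"
  shows "\<exists>t>0. [u ^ t = 1] (mod m)"
proof -
  define v where "v = nat (u mod m)"
  have v: "int v = u mod m" using assms by (simp add: v_def)
  have "coprime (int v) (int (nat m))" unfolding v using assms by simp
  then have "coprime v (nat m)" by (simp only: coprime_int_iff)
  then have "[v ^ totient (nat m) = 1] (mod nat m)" by (rule euler_theorem)
  then have "[int v ^ totient (nat m) = 1] (mod m)"
    using assms(2) by (metis cong_int_iff int_nat_eq of_nat_1 of_nat_power less_imp_le)
  moreover have "[int v ^ totient (nat m) = u ^ totient (nat m)] (mod m)"
    unfolding v by (intro cong_pow) (simp add: cong_def)
  ultimately have "[u ^ totient (nat m) = 1] (mod m)" using cong_sym cong_trans by blast
  then show ?thesis using assms(2) by (intro exI[of _ "totient (nat m)"]) simp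
qed

theorem corollary6:
  fixes r :: rat and S :: "nat set"
  assumes "r \<noteq> 0" and "r \<noteq> 1" and "r \<noteq> -1"
    and "S \<subseteq> {p. prime p}" and "S \<noteq> {p. prime p}"
    and "\<And>p. prime p \<Longrightarrow> p \<notin> S \<Longrightarrow> padic_abs p r = 1"
    and "fps_conv_radius (F_S r S) = 1"
  shows "is_natural_boundary (F_S r S) (sphere 0 1)"
proof -
  obtain u w where q: "quotient_of r = (u, w)" by (cases "quotient_of r")
  have w: "w > 0" and cop: "coprime u w" and r: "r = of_int u / of_int w"
    using quotient_of_denom_pos[OF q] quotient_of_coprime[OF q] quotient_of_div[OF q] by auto
  have "u \<noteq> 0" using r assms(1) by auto
  \<comment> \<open>\<open>padic_abs p r = 1\<close> gives \<open>u\<close> and \<open>w\<close>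
    equal multiplicity at \<open>p\<close>; being coprime, both have multiplicity 0.\<close>
  have unit: "\<not> int p dvd u" "\<not> int p dvd w" if "prime p" "p \<notin> S" for p
  proof -
    have "real p powi (int (multiplicity (int p) w) - int (multiplicity (int p) u)) = 1"
      using assms(6)[OF that] assms(1) by (simp add: padic_abs_def q)
    then have "multiplicity (int p) w = multiplicity (int p) u"
      using prime_gt_1_nat[OF that(1)] by (simp add: power_int_diff)
    moreover have "int p dvd x \<longleftrightarrow> multiplicity (int p) x \<noteq> 0" if "x \<noteq> 0" for x
      using \<open>prime p\<close> that by (simp add: prime_multiplicity_gt_zero_iff)
    ultimately have "int p dvd u \<longleftrightarrow> int p dvd w" using \<open>u \<noteq> 0\<close> w by simp
    moreover have "\<not> (int p dvd u \<and> int p dvd w)"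
      using cop \<open>prime p\<close> by (metis coprime_common_divisor not_prime_unit prime_nat_int_transfer)
    ultimately show "\<not> int p dvd u" "\<not> int p dvd w" by blast+
  qed
  obtain p where p: "prime p" "p \<notin> S" using assms(4,5) by blast
  \<comment> \<open>As \<open>r\<close> is neither 1 nor -1, one of \<open>u\<close>,
    \<open>w\<close> is a non-unit, and by \<open>unit\<close> its prime factors lie in
    \<open>S\<close>.\<close>
  obtain s where s: "prime s" "s \<in> S"
  proof -
    have "\<not> (is_unit u \<and> is_unit w)" using r w assms(2,3) by auto
    then obtain x where "x \<in> {u, w}" "\<not> is_unit x" by blast
    then have "nat \<bar>x\<bar> \<noteq> 1" by auto
    then obtain s where "prime s" "int s dvd x"
      using prime_factor_nat[of "nat \<bar>x\<bar>"] dvd_nat_abs_iff by blast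
    then show thesis using that unit \<open>x \<in> {u, w}\<close> by blast
  qed
  have ne: "u ^ n \<noteq> w ^ n" if "n > 0" for n
  proof
    assume "u ^ n = w ^ n"
    then have "\<bar>u\<bar> ^ n = w ^ n" using w by (metis abs_of_pos power_abs)
    then have "\<bar>u\<bar> = w" using that w by (simp add: power_eq_iff_eq_base)
    then have "u = w \<or> u = - w" by linarith
    then show False using r w assms(2,3) by auto
  qed
  define c where "c n = nat \<bar>u ^ n - w ^ n\<bar>" for n
  define a where "a n = (if n = 0 then 0 else int (coprime_part S (c n)))" for n
  have coeff: "fps_nth (F_S r S) n = of_int (a n)" for n
  proof (cases "n = 0")
    case False
    note q' = quotient_of_power_minus_1[OF q, of n]
    have "f_S r S n = real (coprime_part S (c n))"
      unfolding f_S_def c_def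
    proof (rule abs_mult_S_abs[OF _ q'])
      show "prime p" if "p \<in> S" for p using that assms(4) by blast
      show "r ^ n - 1 \<noteq> 0"
      proof
        assume "r ^ n - 1 = 0"
        then show False using q' ne[of n] False by simp
      qed
      show "p \<in> S" if "prime p" "int p dvd w ^ n" for p
        using unit(2)[of p] that prime_dvd_power[of "int p" w n] by auto
    qed
    then show ?thesis using False by (simp add: F_S_def a_def)
  qed (simp add: F_S_def a_def)
  have "\<not> (\<exists>U g. open U \<and> connected U \<and> ball 0 1 \<subset> U \<and> g holomorphic_on U \<and>
      (\<forall>z\<in>ball 0 1. g z = eval_fps (F_S r S) z))"
  proof
    assume "\<exists>U g. open U \<and> connected U \<and> ball 0 1 \<subset> U \<and> g holomorphic_on U \<and>
      (\<forall>z\<in>ball 0 1. g z = eval_fps (F_S r S) z)"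
    then obtain U g where U: "open U" "connected U" "ball 0 1 \<subset> U" "g holomorphic_on U"
      and g: "\<And>z. z \<in> ball 0 1 \<Longrightarrow> g z = eval_fps (F_S r S) z" by blast
    obtain n0 where "\<And>n. n \<ge> n0 \<Longrightarrow> det (hankel a 0 n) = 0"
      by (rule integer_series_continuation_imp_hankel_0[OF U _ coeff g]) (use assms(7) in auto)
    then show False
    proof (rule eventually_zero_hankel_contradiction[where p = "int p" and s = "int s"])
      show "\<exists>C. \<forall>n. \<bar>real_of_int (a n)\<bar> \<le> C * x ^ n" if "x > 1" for x :: real
        using fps_conv_radius_coeff_bound[OF assms(7) that] by (simp add: coeff)
      show "int p > 1" "int s > 1" using prime_gt_1_nat p(1) s(1) by auto
      show "\<not> int s dvd a n" if "n > 0" for n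
        using not_dvd_coprime_part[OF s] that by (simp add: a_def)
      show "\<exists>Q>0. \<forall>j>0. int p ^ k dvd a (j * Q)" for k
      proof -
        have cop': "coprime x (int p ^ k)" if "\<not> int p dvd x" for x
          using that p(1) by (metis coprime_commute coprime_power_left_iff prime_imp_coprime prime_nat_int_transfer)
        obtain t1 where t1: "t1 > 0" "[u ^ t1 = 1] (mod int p ^ k)"
          using coprime_imp_ex_power_cong_1[OF cop'[OF unit(1)[OF p]]] prime_gt_0_nat[OF p(1)] by auto
        obtain t2 where t2: "t2 > 0" "[w ^ t2 = 1] (mod int p ^ k)"
          using coprime_imp_ex_power_cong_1[OF cop'[OF unit(2)[OF p]]] prime_gt_0_nat[OF p(1)] by auto
        \<comment> \<open>At positive multiples of \<open>t1 * t2\<close> both powers are 1 modulo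
          \<open>p ^ k\<close>, so their difference is divisible by \<open>p ^ k\<close>.\<close>
        show ?thesis
        proof (intro exI[of _ "t1 * t2"] conjI allI impI)
          fix j :: nat assume "j > 0"
          define n where "n = j * (t1 * t2)"
          have "n > 0" using \<open>j > 0\<close> t1 t2 by (simp add: n_def)
          have "[(u ^ t1) ^ (t2 * j) = 1 ^ (t2 * j)] (mod int p ^ k)"
            "[(w ^ t2) ^ (t1 * j) = 1 ^ (t1 * j)] (mod int p ^ k)"
            by (intro cong_pow t1 t2)+
          then have "[u ^ n = 1] (mod int p ^ k)" "[w ^ n = 1] (mod int p ^ k)"
            by (simp_all add: n_def mult_ac flip: power_mult)
          then have "[u ^ n = w ^ n] (mod int p ^ k)" using cong_sym cong_trans by blast
          then have "int (p ^ k) dvd u ^ n - w ^ n" by (simp add: cong_iff_dvd_diff)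
          then have "p ^ k dvd c n" by (simp add: c_def del: of_nat_power)
          moreover have "c n > 0" using ne[OF \<open>n > 0\<close>] by (simp add: c_def)
          ultimately have "p ^ k dvd coprime_part S (c n)"
            using p by (intro prime_power_dvd_coprime_part)
          then show "int p ^ k dvd a (j * (t1 * t2))"
            using \<open>n > 0\<close> by (simp add: a_def flip: n_def of_nat_power)
        qed (use t1 t2 in simp)
      qed
    qed
  qed
  then show ?thesis
    unfolding is_natural_boundary_def using assms(7) by (intro exI[of _ 1]) auto
qed

end
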